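(* Let $G=G_1\ast_A G_2$ be an amalgam of finite groups, and let $H=\langle h_1,\ldots,h_n\rangle$ and $K=\langle k_1,\ldots,k_m\rangle$ be finitely generated subgroups of $G$. Then $H\cap K$ is finitely generated, and there exists an algorithm which, given $h_1,\ldots,h_n,k_1,\ldots,k_m$, finds (a finite set of) generators of $H\cap K$.
   Context: $G=G_1\ast_A G_2$ is a free product with amalgamation, where $G_1=\langle X_1\mid R_1\rangle$ and $G_2=\langle X_2\mid R_2\rangle$ are finite groups given by finite presentations with $X_1^{\pm}\cap X_2^{\pm}=\emptyset$, $A$ is a group generated by $Y$ with monomorphisms $\phi_i:A\to G_i$ ($i=1,2$), and $G=\langle X_1\cup X_2\mid R_1,R_2,\ \phi_1(a)=\phi_2(a)\ (a\in Y)\rangle$. The amalgam (the finite groups $G_1,G_2,A$, their presentations, the monomorphisms) is fixed and known to the algorithm. Elements of $G$ are input and output as words in the letters $X^{\pm}$, where $X=X_1\cup X_2$. *)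

theory Defs
  imports "HOL-Algebra.Generated_Groups" "HOL-Library.Nat_Bijection"
begin

section \<open>Words and group presentations\<close>

text \<open>The letter \<open>(x, True)\<close> stands for \<open>x\<close> and \<open>(x, False)\<close> for its formal inverse.
  Words need not be freely reduced.\<close>

type_synonym 'x word = "('x \<times> bool) list"

definition words :: "'x set \<Rightarrow> 'x word set" where
  "words X = lists (X \<times> UNIV)"

definition word_inv :: "'x word \<Rightarrow> 'x word" where
  "word_inv w = rev (map (\<lambda>(x, b). (x, \<not> b)) w)"

text \<open>Equality of words in the group presented by generators \<open>X\<close> and relators \<open>R\<close>.\<close>

inductive word_eq :: "'x set \<Rightarrow> 'x word set \<Rightarrow> 'x word \<Rightarrow> 'x word \<Rightarrow> bool"
  for X :: "'x set" and R :: "'x word set"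
where
  refl: "w \<in> words X \<Longrightarrow> word_eq X R w w"
| sym: "word_eq X R u v \<Longrightarrow> word_eq X R v u"
| trans: "word_eq X R u v \<Longrightarrow> word_eq X R v w \<Longrightarrow> word_eq X R u w"
| cancel: "u \<in> words X \<Longrightarrow> v \<in> words X \<Longrightarrow> x \<in> X \<Longrightarrow>
    word_eq X R (u @ [(x, b), (x, \<not> b)] @ v) (u @ v)"
| relator: "u \<in> words X \<Longrightarrow> v \<in> words X \<Longrightarrow> r \<in> R \<Longrightarrow> r \<in> words X \<Longrightarrow>
    word_eq X R (u @ r @ v) (u @ v)"

definition word_class :: "'x set \<Rightarrow> 'x word set \<Rightarrow> 'x word \<Rightarrow> 'x word set" where
  "word_class X R w = {v. word_eq X R w v}"

definition presented_group :: "'x set \<Rightarrow> 'x word set \<Rightarrow> 'x word set monoid" where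
  "presented_group X R =
    \<lparr>carrier = words X // {(u, v). word_eq X R u v},
     mult = (\<lambda>U V. \<Union>u\<in>U. \<Union>v\<in>V. word_class X R (u @ v)),
     one = word_class X R []\<rparr>"

lemma word_eq_words: "word_eq X R u v \<Longrightarrow> u \<in> words X \<and> v \<in> words X"
  by (induction rule: word_eq.induct) (auto simp: words_def)

lemma word_eq_append_left:
  assumes "word_eq X R u v" "w \<in> words X"
  shows "word_eq X R (w @ u) (w @ v)"
  using assms
proof (induction rule: word_eq.induct)
  case (cancel u v x b)
  then show ?case
    using word_eq.cancel[of "w @ u" X v x R b] by (simp add: words_def)
next
  case (relator u v r)
  then show ?case
    using word_eq.relator[of "w @ u" X v r R] by (simp add: words_def)
next
  case (refl u)
  then show ?case by (simp add: words_def word_eq.refl)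
next
  case (sym u v)
  then show ?case by (simp add: word_eq.sym)
next
  case (trans u v v')
  show ?case by (rule word_eq.trans[OF trans.IH(1)[OF trans.prems] trans.IH(2)[OF trans.prems]])
qed

lemma word_eq_append_right:
  assumes "word_eq X R u v" "w \<in> words X"
  shows "word_eq X R (u @ w) (v @ w)"
  using assms
proof (induction rule: word_eq.induct)
  case (cancel u v x b)
  then show ?case
    using word_eq.cancel[of u X "v @ w" x R b] by (simp add: words_def)
next
  case (relator u v r)
  then show ?case
    using word_eq.relator[of u X "v @ w" r R] by (simp add: words_def)
next
  case (refl u)
  then show ?case by (simp add: words_def word_eq.refl)
next
  case (sym u v)
  then show ?case by (simp add: word_eq.sym)
next
  case (trans u v v')
  show ?case by (rule word_eq.trans[OF trans.IH(1)[OF trans.prems] trans.IH(2)[OF trans.prems]])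
qed

lemma word_eq_append:
  assumes "word_eq X R u u'" "word_eq X R v v'"
  shows "word_eq X R (u @ v) (u' @ v')"
proof (rule word_eq.trans)
  show "word_eq X R (u @ v) (u' @ v)"
    by (rule word_eq_append_right) (use assms word_eq_words[of X R v v'] in auto)
  show "word_eq X R (u' @ v) (u' @ v')"
    by (rule word_eq_append_left) (use assms word_eq_words[of X R u u'] in auto)
qed

lemma word_class_eqI:
  assumes "word_eq X R u v"
  shows "word_class X R u = word_class X R v"
proof -
  have "word_eq X R u w \<longleftrightarrow> word_eq X R v w" for w
    using word_eq.trans[OF assms, of w] word_eq.trans[OF word_eq.sym[OF assms], of w] by iprover
  then show ?thesis by (simp add: word_class_def)
qed

lemma word_class_eq_iff:
  assumes "v \<in> words X"
  shows "word_class X R u = word_class X R v \<longleftrightarrow> word_eq X R u v"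
proof
  assume eq: "word_class X R u = word_class X R v"
  have "v \<in> word_class X R v"
    using assms by (simp add: word_class_def word_eq.refl)
  then have "v \<in> word_class X R u" by (simp only: eq)
  then show "word_eq X R u v" by (simp add: word_class_def)
qed (rule word_class_eqI)

lemma carrier_presented_group: "carrier (presented_group X R) = word_class X R ` words X"
  unfolding presented_group_def quotient_def word_class_def by auto

lemma one_presented_group: "\<one>\<^bsub>presented_group X R\<^esub> = word_class X R []"
  unfolding presented_group_def by simp

lemma mult_presented_group:
  assumes "u \<in> words X" "v \<in> words X"
  shows "word_class X R u \<otimes>\<^bsub>presented_group X R\<^esub> word_class X R v = word_class X R (u @ v)"
proof -
  have "word_class X R (u' @ v') = word_class X R (u @ v)"
    if "u' \<in> word_class X R u" "v' \<in> word_class X R v" for u' v'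
    using that word_class_eqI[OF word_eq_append[of X R u u' v v']] by (simp add: word_class_def)
  then have "(\<Union>u'\<in>word_class X R u. \<Union>v'\<in>word_class X R v. word_class X R (u' @ v')) =
      (\<Union>u'\<in>word_class X R u. \<Union>v'\<in>word_class X R v. word_class X R (u @ v))"
    by (intro SUP_cong) simp_all
  moreover have "word_class X R u \<noteq> {}" "word_class X R v \<noteq> {}"
    using assms by (auto simp: word_class_def intro: word_eq.refl)
  ultimately show ?thesis
    by (simp add: presented_group_def)
qed

lemma word_inv_in_words: "w \<in> words X \<Longrightarrow> word_inv w \<in> words X"
  by (induction w) (auto simp: words_def word_inv_def)

lemma word_eq_inv_left: "w \<in> words X \<Longrightarrow> word_eq X R (word_inv w @ w) []"
proof (induction w)
  case Nil
  then show ?case by (auto simp: word_inv_def intro: word_eq.refl)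
next
  case (Cons l w)
  obtain x b where l: "l = (x, b)" by fastforce
  have w: "w \<in> words X" and x: "x \<in> X" using Cons.prems l by (auto simp: words_def)
  have "word_eq X R (word_inv w @ [(x, \<not> b), (x, \<not> \<not> b)] @ w) (word_inv w @ w)"
    by (rule word_eq.cancel) (use w x word_inv_in_words in auto)
  then show ?case
    using word_eq.trans[OF _ Cons.IH[OF w]] by (simp add: word_inv_def l)
qed

lemma group_presented_group: "group (presented_group X R)"
proof (rule groupI)
  show "\<one>\<^bsub>presented_group X R\<^esub> \<in> carrier (presented_group X R)"
    by (auto simp: carrier_presented_group one_presented_group words_def)
next
  fix U assume "U \<in> carrier (presented_group X R)"
  then obtain u where u: "u \<in> words X" "U = word_class X R u"
    by (auto simp: carrier_presented_group)
  show "\<one>\<^bsub>presented_group X R\<^esub> \<otimes>\<^bsub>presented_group X R\<^esub> U = U"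
    using u mult_presented_group[of "[]" X u R] by (simp add: one_presented_group words_def)
  show "\<exists>V\<in>carrier (presented_group X R). V \<otimes>\<^bsub>presented_group X R\<^esub> U = \<one>\<^bsub>presented_group X R\<^esub>"
    using u word_inv_in_words[OF u(1)] mult_presented_group[OF word_inv_in_words[OF u(1)] u(1), of R]
      word_class_eqI[OF word_eq_inv_left[OF u(1)], of R]
    by (auto simp: carrier_presented_group one_presented_group)
next
  fix U V assume "U \<in> carrier (presented_group X R)" "V \<in> carrier (presented_group X R)"
  then obtain u v where uv: "u \<in> words X" "U = word_class X R u" "v \<in> words X" "V = word_class X R v"
    by (auto simp: carrier_presented_group)
  have "u @ v \<in> words X" using uv by (simp add: words_def)
  then show "U \<otimes>\<^bsub>presented_group X R\<^esub> V \<in> carrier (presented_group X R)"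
    using uv by (auto simp: mult_presented_group carrier_presented_group)
  fix W assume "W \<in> carrier (presented_group X R)"
  then obtain w where w: "w \<in> words X" "W = word_class X R w"
    by (auto simp: carrier_presented_group)
  have "v @ w \<in> words X" using uv w by (simp add: words_def)
  then show "U \<otimes>\<^bsub>presented_group X R\<^esub> V \<otimes>\<^bsub>presented_group X R\<^esub> W
      = U \<otimes>\<^bsub>presented_group X R\<^esub> (V \<otimes>\<^bsub>presented_group X R\<^esub> W)"
    using uv w \<open>u @ v \<in> words X\<close> by (simp add: mult_presented_group)
qed

section \<open>Amalgams\<close>

text \<open>An element \<open>\<phi> a\<close> of a presented group is a class of words.  The relation
  \<open>\<phi>1 a = \<phi>2 a\<close> is imposed for all words representing the two sides; in the presence of
  the relators \<open>R1\<close> and \<open>R2\<close> this amounts to imposing it for one choice of words.\<close>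

definition amalgam_relators ::
  "'x word set \<Rightarrow> 'x word set \<Rightarrow> 'a set \<Rightarrow> ('a \<Rightarrow> 'x word set) \<Rightarrow> ('a \<Rightarrow> 'x word set) \<Rightarrow> 'x word set"
where
  "amalgam_relators R1 R2 Y \<phi>1 \<phi>2 =
    R1 \<union> R2 \<union> {u @ word_inv v | a u v. a \<in> Y \<and> u \<in> \<phi>1 a \<and> v \<in> \<phi>2 a}"

definition finitely_generated :: "('g, 'm) monoid_scheme \<Rightarrow> 'g set \<Rightarrow> bool" where
  "finitely_generated G H \<longleftrightarrow> (\<exists>S. finite S \<and> S \<subseteq> carrier G \<and> H = generate G S)"

section \<open>Algorithms\<close>

text \<open>The general recursive functions of Kleene: the least class containing the initial functions
  and closed under composition, primitive recursion, and minimization of regular functions.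
  A \<open>k\<close>-ary function is represented by a function on lists, and only its values on lists of
  length \<open>k\<close> are significant.\<close>

inductive recursive :: "nat \<Rightarrow> (nat list \<Rightarrow> nat) \<Rightarrow> bool" where
  zero: "recursive k (\<lambda>xs. 0)"
| succ: "recursive 1 (\<lambda>xs. Suc (hd xs))"
| proj: "i < k \<Longrightarrow> recursive k (\<lambda>xs. xs ! i)"
| comp: "recursive (length gs) f \<Longrightarrow> (\<forall>g\<in>set gs. recursive k g) \<Longrightarrow>
    recursive k (\<lambda>xs. f (map (\<lambda>g. g xs) gs))"
| prim_rec: "recursive k f \<Longrightarrow> recursive (Suc (Suc k)) g \<Longrightarrow>
    recursive (Suc k) (\<lambda>xs. rec_nat (f (tl xs)) (\<lambda>n r. g (n # r # tl xs)) (hd xs))"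
| minimize: "recursive (Suc k) f \<Longrightarrow> (\<forall>xs. length xs = k \<longrightarrow> (\<exists>y. f (y # xs) = 0)) \<Longrightarrow>
    recursive k (\<lambda>xs. LEAST y. f (y # xs) = 0)"

text \<open>Codes of words and of lists of words, relative to a numbering \<open>c\<close> of the generators.\<close>

definition word_code :: "('x \<Rightarrow> nat) \<Rightarrow> 'x word \<Rightarrow> nat" where
  "word_code c w = list_encode (map (\<lambda>(x, b). 2 * c x + of_bool b) w)"

definition words_code :: "('x \<Rightarrow> nat) \<Rightarrow> 'x word list \<Rightarrow> nat" where
  "words_code c ws = list_encode (map (word_code c) ws)"

end

theory Submission
  imports Defs
begin

text \<open>
  Both claims follow from the fact that \<open>G\<close> acts on a tree with finite stabilisers.  No tree
  is built.  What is used of it is the \<^emph>\<open>length\<close> of an element, the number of syllables in its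
  normal form, together with the normal forms themselves, whose prefixes play the part of
  geodesics.

  Normal forms come from van der Waerden's method.  Each factor acts on the set of formal normal
  forms (a stack of coset representatives, alternating between the factors, together with an
  element of \<open>A\<close>), the two actions agree on \<open>A\<close>, and hence words in the generators act so that
  words with the same value in \<open>G\<close> act in the same way.  A letter only changes the top of the
  stack.  Therefore, whenever a product \<open>y\<^sub>1 \<cdots> y\<^sub>k\<close> is formed, every prefix of the normal form of
  the result was once the whole stack, and so it stays close to some partial product
  \<open>y\<^sub>1 \<cdots> y\<^sub>j\<close> (\<open>bottleneck\<close>).

  If \<open>H\<close> is generated by elements of length at most \<open>m\<close>, all prefixes of normal forms of elements
  of \<open>H\<close> are therefore within distance \<open>m\<close> of \<open>H\<close>.  Take \<open>g \<in> H \<inter> K\<close>, both subgroups being of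
  this kind.  Balls are finite, so among sufficiently many prefixes of \<open>g\<close> two are in the same
  position with respect to \<open>H\<close> and to \<open>K\<close>; cutting out the piece between them splits off a short
  element of \<open>H \<inter> K\<close> and shortens \<open>g\<close>.  So \<open>H \<inter> K\<close> is generated by its elements of length at most
  \<open>L\<close>, where \<open>L\<close> is an explicit function of \<open>m\<close> (\<open>inter_generated\<close>).  This is the first claim.

  For the algorithm it remains to list \<open>H \<inter> K\<close> up to length \<open>L\<close>.  The elements of \<open>H\<close> up to
  length \<open>L\<close> are found by saturation: any set that contains the generators and their inverses and
  is closed under those products that have length at most \<open>L\<close> already contains them all
  (\<open>saturated_contains_ball\<close>, again by the bottleneck property).  Being saturated is decidable,
  because normal forms solve the word problem and are computed letter by letter by a stack machine
  with finite control; saturated sets of elements of \<open>H\<close> exist.  So unbounded search finds one for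
  \<open>H\<close> and one for \<open>K\<close>, and a further search finds words for the common elements.
\<close>

section \<open>Group elements as products of lists\<close>

context group
begin

definition lprod :: "'a list \<Rightarrow> 'a" where
  "lprod ys = foldr (\<otimes>) ys \<one>"

lemma lprod_Nil [simp]: "lprod [] = \<one>"
  and lprod_Cons [simp]: "lprod (y # ys) = y \<otimes> lprod ys"
  by (simp_all add: lprod_def)

lemma lprod_closed [simp, intro]: "set ys \<subseteq> carrier G \<Longrightarrow> lprod ys \<in> carrier G"
  by (induction ys) auto

lemma lprod_append: "set xs \<subseteq> carrier G \<Longrightarrow> set ys \<subseteq> carrier G \<Longrightarrow> lprod (xs @ ys) = lprod xs \<otimes> lprod ys"
  by (induction xs) (auto simp: m_assoc)

lemma lprod_in_subgroup: "subgroup H G \<Longrightarrow> set ys \<subseteq> H \<Longrightarrow> lprod ys \<in> H"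
  by (induction ys) (auto simp: subgroup.one_closed subgroup.m_closed)

lemma generate_eq_lprod:
  assumes "S \<subseteq> carrier G"
  shows "generate G S = lprod ` lists (S \<union> m_inv G ` S)"
proof
  show "generate G S \<subseteq> lprod ` lists (S \<union> m_inv G ` S)"
  proof
    fix g assume "g \<in> generate G S"
    then show "g \<in> lprod ` lists (S \<union> m_inv G ` S)"
    proof induction
      case one
      then show ?case by (intro image_eqI[of _ _ "[]"]) auto
    next
      case (incl h)
      then show ?case using assms by (intro image_eqI[of _ _ "[h]"]) auto
    next
      case (inv h)
      then show ?case using assms by (intro image_eqI[of _ _ "[inv h]"]) auto
    next
      case (eng h1 h2)
      then obtain ys zs where *: "ys \<in> lists (S \<union> m_inv G ` S)" "zs \<in> lists (S \<union> m_inv G ` S)"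
        "h1 = lprod ys" "h2 = lprod zs" by blast
      moreover have "S \<union> m_inv G ` S \<subseteq> carrier G" using assms by auto
      then have "set ys \<subseteq> carrier G" "set zs \<subseteq> carrier G" using * by blast+
      ultimately show ?case by (intro image_eqI[of _ _ "ys @ zs"]) (auto simp: lprod_append)
    qed
  qed
  have "S \<union> m_inv G ` S \<subseteq> generate G S"
    by (auto intro: generate.incl generate.inv)
  then show "lprod ` lists (S \<union> m_inv G ` S) \<subseteq> generate G S"
    using lprod_in_subgroup[OF generate_is_subgroup[OF assms]] unfolding lists_eq_set by blast
qed

end

section \<open>Subgroups of a group with a tree-like length\<close>

text \<open>The model is a group acting on a tree, with \<open>len g\<close> the distance from a base point to its image
  under \<open>g\<close>, so that \<open>len (inv g \<otimes> h)\<close> is the distance between the images under \<open>g\<close> and \<open>h\<close>.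
  The elements \<open>pre g 0, \<dots>, pre g (len g)\<close> mark the geodesic from the base point to its image
  under \<open>g\<close>.  The last assumption expresses the absence of cycles: the geodesic to \<open>g \<otimes> h\<close> follows
  the one to \<open>g\<close> until it is at most \<open>len h\<close> away from \<open>g\<close>.\<close>

locale tree_length = group G for G :: "('g, 'm) monoid_scheme" (structure) +
  fixes len :: "'g \<Rightarrow> nat" and pre :: "'g \<Rightarrow> nat \<Rightarrow> 'g"
  assumes len_one: "len \<one> = 0"
    and len_mult: "g \<in> carrier G \<Longrightarrow> h \<in> carrier G \<Longrightarrow> len (g \<otimes> h) \<le> len g + len h"
    and len_inv: "g \<in> carrier G \<Longrightarrow> len (inv g) \<le> len g"
    and finite_ball: "finite {g \<in> carrier G. len g \<le> n}"
    and pre_closed: "g \<in> carrier G \<Longrightarrow> i \<le> len g \<Longrightarrow> pre g i \<in> carrier G"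
    and len_pre: "g \<in> carrier G \<Longrightarrow> i \<le> len g \<Longrightarrow> len (pre g i) \<le> i"
    and len_suffix: "g \<in> carrier G \<Longrightarrow> i \<le> len g \<Longrightarrow> len (inv (pre g i) \<otimes> g) \<le> len g - i"
    and pre_mult: "g \<in> carrier G \<Longrightarrow> h \<in> carrier G \<Longrightarrow> i \<le> len (g \<otimes> h) \<Longrightarrow>
      i \<le> len g \<and> pre (g \<otimes> h) i = pre g i \<or> len (inv g \<otimes> pre (g \<otimes> h) i) \<le> len h"
begin

abbreviation ball :: "nat \<Rightarrow> 'g set" where
  "ball n \<equiv> {g \<in> carrier G. len g \<le> n}"

lemma ball_Un_inv:
  assumes "S \<subseteq> ball m"
  shows "S \<union> m_inv G ` S \<subseteq> ball m"
  using assms by (auto dest!: subsetD intro: order_trans[OF len_inv])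

text \<open>In a tree, a path that makes steps of length at most \<open>m\<close> comes within \<open>m\<close> of each point of the
  geodesic between its ends.  Here the path is that of the partial products.\<close>

lemma bottleneck:
  assumes "set ys \<subseteq> ball m" "i \<le> len (lprod ys)"
  shows "\<exists>j\<le>length ys. len (inv (lprod (take j ys)) \<otimes> pre (lprod ys) i) \<le> m"
  using assms
proof (induction ys rule: rev_induct)
  case Nil
  then have "i = 0" by (simp add: len_one)
  then show ?case using pre_closed[of \<one> 0] len_pre[of \<one> 0] by (auto simp: len_one)
next
  case (snoc y ys)
  let ?g = "lprod ys"
  have c: "set ys \<subseteq> carrier G" "y \<in> carrier G" "?g \<in> carrier G" and y: "len y \<le> m"
    using snoc.prems by auto
  have eq: "lprod (ys @ [y]) = ?g \<otimes> y" using c by (simp add: lprod_append)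
  from pre_mult[OF c(3,2), of i] snoc.prems(2) eq
  consider "i \<le> len ?g" "pre (?g \<otimes> y) i = pre ?g i" | "len (inv ?g \<otimes> pre (?g \<otimes> y) i) \<le> len y"
    by auto
  then show ?case
  proof cases
    case 1
    with snoc obtain j where "j \<le> length ys" "len (inv (lprod (take j ys)) \<otimes> pre ?g i) \<le> m" by auto
    then show ?thesis using 1 eq by (intro exI[of _ j]) auto
  next
    case 2
    then show ?thesis using eq y by (intro exI[of _ "length ys"]) auto
  qed
qed

text \<open>Finitely generated subgroups are quasiconvex: the geodesics between their elements remain in a
  bounded neighbourhood of the subgroup.\<close>

lemma near_subgroup:
  assumes S: "S \<subseteq> ball m" and g: "g \<in> generate G S" and i: "i \<le> len g"
  obtains u where "u \<in> generate G S" "inv u \<otimes> pre g i \<in> ball m"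
proof -
  have SG: "S \<subseteq> carrier G" using S by auto
  obtain ys where ys: "set ys \<subseteq> S \<union> m_inv G ` S" "g = lprod ys"
    using g unfolding generate_eq_lprod[OF SG] by auto
  have *: "S \<union> m_inv G ` S \<subseteq> ball m" by (rule ball_Un_inv[OF S])
  obtain j where j: "len (inv (lprod (take j ys)) \<otimes> pre g i) \<le> m"
    using bottleneck[of ys m i] ys * i by blast
  have t: "set (take j ys) \<subseteq> S \<union> m_inv G ` S" using ys(1) set_take_subset by fastforce
  have "lprod (take j ys) \<in> generate G S" unfolding generate_eq_lprod[OF SG] using t by blast
  moreover have "lprod (take j ys) \<in> carrier G" "pre g i \<in> carrier G"
    using t * generate_in_carrier[OF SG g] pre_closed[OF _ i] by auto
  ultimately show ?thesis using j that[of "lprod (take j ys)"] by auto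
qed

text \<open>Each point of the geodesic of \<open>g\<close> has a position relative to \<open>generate G S\<close>, namely the element of
  \<open>ball m\<close> that leads to it from a nearby element of that subgroup, and likewise a position relative
  to \<open>generate G S'\<close>.  Two points \<open>p\<close>, \<open>q\<close> with the same pair of positions differ by an element
  \<open>p \<otimes> inv q\<close> of both subgroups, and if \<open>p\<close> comes first, then \<open>p \<otimes> inv q \<otimes> g\<close> is shorter than \<open>g\<close>.
  By the pigeonhole principle, such points occur among the first \<open>card (ball m) ^ 2 + 1\<close> ones, and
  this makes \<open>p \<otimes> inv q\<close> short.\<close>

lemma inter_generated:
  assumes S: "S \<subseteq> ball m" and S': "S' \<subseteq> ball m" and L: "2 * card (ball m) ^ 2 \<le> L"
  shows "generate G (generate G S \<inter> generate G S' \<inter> ball L) = generate G S \<inter> generate G S'"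
    (is "generate G ?B = ?H \<inter> ?K")
proof
  have SG: "S \<subseteq> carrier G" "S' \<subseteq> carrier G" using S S' by auto
  have sub: "subgroup (?H \<inter> ?K) G"
    by (intro subgroups_Inter_pair generate_is_subgroup SG)
  have BG: "?B \<subseteq> carrier G" by auto
  show "generate G ?B \<subseteq> ?H \<inter> ?K"
    by (rule generate_subgroup_incl[OF _ sub]) auto
  show "?H \<inter> ?K \<subseteq> generate G ?B"
  proof
    fix g assume "g \<in> ?H \<inter> ?K"
    then show "g \<in> generate G ?B"
    proof (induction "len g" arbitrary: g rule: less_induct)
      case less
      let ?N = "card (ball m) ^ 2"
      have gG: "g \<in> carrier G" using less.prems subgroup.mem_carrier[OF sub] by blast
      show ?case
      proof (cases "len g \<le> L")
        case True
        then show ?thesis using less.prems gG by (intro generate.incl) auto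
      next
        case False
        then have N: "?N \<le> len g" using L by simp
        have "\<exists>u. u \<in> generate G U \<and> inv u \<otimes> pre g i \<in> ball m"
          if "U \<subseteq> ball m" "g \<in> generate G U" "i \<le> ?N" for U i
          using near_subgroup[OF that(1,2), of i] that(3) N by (metis le_trans)
        then have "\<forall>i\<in>{..?N}. \<exists>u. u \<in> ?H \<and> inv u \<otimes> pre g i \<in> ball m"
          "\<forall>i\<in>{..?N}. \<exists>v. v \<in> ?K \<and> inv v \<otimes> pre g i \<in> ball m"
          using S S' less.prems by blast+
        from this[THEN bchoice] obtain u v where uv: "\<And>i. i \<le> ?N \<Longrightarrow> u i \<in> ?H \<and> v i \<in> ?K \<and>
            inv (u i) \<otimes> pre g i \<in> ball m \<and> inv (v i) \<otimes> pre g i \<in> ball m"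
          by auto
        define f where "f i = (inv (u i) \<otimes> pre g i, inv (v i) \<otimes> pre g i)" for i
        have "f ` {..?N} \<subseteq> ball m \<times> ball m" using uv by (auto simp: f_def)
        then have "card (f ` {..?N}) \<le> card (ball m \<times> ball m)"
          by (intro card_mono finite_SigmaI finite_ball)
        also have "\<dots> = ?N" by (simp add: card_cartesian_product power2_eq_square)
        finally have "\<not> inj_on f {..?N}"
          using card_image[of f "{..?N}"] by fastforce
        then obtain i' j' where "i' \<le> ?N" "j' \<le> ?N" "f i' = f j'" "i' \<noteq> j'"
          unfolding inj_on_def by auto
        then obtain i j where ij: "i < j" "j \<le> ?N" "f i = f j"
          by (cases i' j' rule: linorder_cases) (auto dest: sym)
        define p q where "p = pre g i" and "q = pre g j"
        have ijl: "i \<le> len g" "j \<le> len g" using ij N by auto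
        have pq: "p \<in> carrier G" "q \<in> carrier G" using pre_closed[OF gG] ijl by (auto simp: p_def q_def)
        \<comment> \<open>with \<open>T\<close> standing for \<open>S\<close> and for \<open>S'\<close>\<close>
        have diff: "p \<otimes> inv q \<in> generate G T"
          if T: "T \<subseteq> carrier G" "x \<in> generate G T" "y \<in> generate G T" "inv x \<otimes> p = inv y \<otimes> q" for T x y
        proof -
          have xy: "x \<in> carrier G" "y \<in> carrier G" using T generate_in_carrier by auto
          have "p = x \<otimes> (inv y \<otimes> q)" using T(4) xy pq by (metis inv_closed inv_solve_left m_closed)
          then have "p \<otimes> inv q = x \<otimes> inv y" using xy pq by (simp add: m_assoc)
          then show ?thesis
            using T generate_is_subgroup[OF T(1)] by (simp add: subgroup.m_closed subgroup.m_inv_closed)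
        qed
        have c: "p \<otimes> inv q \<in> ?H \<inter> ?K"
          using diff[OF SG(1), of "u i" "u j"] diff[OF SG(2), of "v i" "v j"] uv[of i] uv[of j] ij
          by (auto simp: p_def q_def f_def)
        have "len (p \<otimes> inv q) \<le> i + j"
          using len_mult[of p "inv q"] len_inv[of q] len_pre[OF gG ijl(1)] len_pre[OF gG ijl(2)] pq
          by (simp add: p_def q_def)
        then have cB: "p \<otimes> inv q \<in> generate G ?B"
          using c pq ij L by (intro generate.incl) auto
        define h where "h = p \<otimes> (inv q \<otimes> g)"
        have h: "h \<in> ?H \<inter> ?K" "h \<in> carrier G"
          using subgroup.m_closed[OF sub c less.prems] pq gG by (auto simp: h_def m_assoc)
        have "len h \<le> i + (len g - j)"
          using len_mult[of p "inv q \<otimes> g"] len_pre[OF gG ijl(1)] len_suffix[OF gG ijl(2)] pq gG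
          unfolding h_def by (simp add: p_def q_def)
        then have "len h < len g" using ij ijl by simp
        then have "h \<in> generate G ?B" using less.hyps h by blast
        moreover have "g = inv (p \<otimes> inv q) \<otimes> h"
          using pq gG by (simp add: h_def m_assoc inv_mult_group) (simp add: m_assoc[symmetric])
        ultimately show ?thesis
          using cB generate_is_subgroup[OF BG] by (metis subgroup.m_closed subgroup.m_inv_closed)
      qed
    qed
  qed
qed

text \<open>Write an element of the subgroup as a product of \<open>k\<close> generators, and use induction on \<open>k\<close>.  It
  suffices to cut the product into two shorter ones that both have length at most \<open>L\<close>.  If the
  length of the product is at most \<open>2 * m + 1\<close>, splitting off one generator does it.  If it is
  larger, the partial products come close to the point at distance \<open>m + 1\<close> on the geodesic, which
  is too far from both ends to be close to the first or to the last partial product; so the product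
  can be cut there.\<close>

lemma saturated_contains_ball:
  assumes S: "S \<subseteq> ball m" and L: "3 * m + 1 \<le> L"
    and T: "\<one> \<in> T" "S \<subseteq> T" "\<And>s. s \<in> S \<Longrightarrow> inv s \<in> T"
    and closed: "\<And>s t. s \<in> T \<Longrightarrow> t \<in> T \<Longrightarrow> s \<otimes> t \<in> ball L \<Longrightarrow> s \<otimes> t \<in> T"
  shows "generate G S \<inter> ball L \<subseteq> T"
proof
  fix g assume g: "g \<in> generate G S \<inter> ball L"
  have SG: "S \<subseteq> carrier G" using S by auto
  have S1: "S \<union> m_inv G ` S \<subseteq> ball m" by (rule ball_Un_inv[OF S])
  obtain ys where "set ys \<subseteq> S \<union> m_inv G ` S" "lprod ys = g"
    using g unfolding generate_eq_lprod[OF SG] by auto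
  then have "lprod ys \<in> ball L" "set ys \<subseteq> S \<union> m_inv G ` S" using g by auto
  then have "lprod ys \<in> T"
  proof (induction "length ys" arbitrary: ys rule: less_induct)
    case less
    let ?g = "lprod ys"
    have ysm: "set ys \<subseteq> ball m" using less.prems S1 by blast
    then have ysG: "set ys \<subseteq> carrier G" by auto
    then have gG: "?g \<in> carrier G" by simp
    have split: "?g \<in> T"
      if "0 < j" "j < length ys" "len (lprod (take j ys)) \<le> L" "len (lprod (drop j ys)) \<le> L" for j
    proof -
      have s: "set (take j ys) \<subseteq> set ys" "set (drop j ys) \<subseteq> set ys"
        by (simp_all add: set_take_subset set_drop_subset)
      have c: "lprod (take j ys) \<in> carrier G" "lprod (drop j ys) \<in> carrier G" using s ysG by auto
      have eq: "?g = lprod (take j ys) \<otimes> lprod (drop j ys)"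
        using lprod_append[of "take j ys" "drop j ys"] s ysG by auto
      have "lprod (take j ys) \<in> T" by (rule less.hyps) (use that c s less.prems in auto)
      moreover have "lprod (drop j ys) \<in> T" by (rule less.hyps) (use that c s less.prems in auto)
      ultimately show ?thesis using closed eq less.prems(1) by metis
    qed
    consider "ys = []" | y where "ys = [y]" | "2 \<le> length ys"
      by (cases ys; cases "tl ys") auto
    then show ?case
    proof cases
      case 1
      then show ?thesis using T by simp
    next
      case 2
      then show ?thesis using T less.prems ysG by auto
    next
      case 3
      show ?thesis
      proof (cases "len ?g \<le> 2 * m + 1")
        case True
        obtain y zs where ys: "ys = y # zs" "zs \<noteq> []" using 3 by (cases ys) (auto simp: Suc_le_eq)
        have c: "y \<in> carrier G" "lprod zs \<in> carrier G" "len y \<le> m" using ys ysm by auto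
        have "lprod zs = inv y \<otimes> ?g" using c ys by (simp add: inv_solve_left)
        then have "len (lprod zs) \<le> m + (2 * m + 1)"
          using len_mult[of "inv y" ?g] len_inv[of y] c gG True by simp
        then show ?thesis using c L ys by (intro split[of 1]) auto
      next
        case False
        define i where "i = m + 1"
        define p where "p = pre ?g i"
        have i: "i \<le> len ?g" using False by (simp add: i_def)
        have p: "p \<in> carrier G" "len p \<le> i" "len (inv p \<otimes> ?g) \<le> len ?g - i"
          using pre_closed[OF gG i] len_pre[OF gG i] len_suffix[OF gG i] by (auto simp: p_def)
        have "len ?g \<le> len p + len (inv p \<otimes> ?g)"
          using len_mult[of p "inv p \<otimes> ?g"] p(1) gG by (simp add: m_assoc[symmetric])
        \<comment> \<open>so \<open>p\<close> is more than \<open>m\<close> away from both ends\<close>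
        then have lp: "m < len p" "m < len (inv p \<otimes> ?g)" using p False i by (auto simp: i_def)
        obtain j where j: "j \<le> length ys" "len (inv (lprod (take j ys)) \<otimes> p) \<le> m"
          using bottleneck[OF ysm i] by (auto simp: p_def)
        define q r where "q = lprod (take j ys)" and "r = lprod (drop j ys)"
        have s: "set (take j ys) \<subseteq> carrier G" "set (drop j ys) \<subseteq> carrier G"
          using ysG set_take_subset[of j ys] set_drop_subset[of j ys] by auto
        then have c: "q \<in> carrier G" "r \<in> carrier G" and g: "?g = q \<otimes> r"
          using lprod_append[of "take j ys" "drop j ys"] by (auto simp: q_def r_def)
        have qp: "len (inv q \<otimes> p) \<le> m" "len (inv p \<otimes> q) \<le> m"
          using j len_inv[of "inv q \<otimes> p"] c p by (auto simp: q_def inv_mult_group)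
        have "j \<noteq> 0"
        proof
          assume "j = 0"
          then show False using qp(1) lp(1) p(1) by (simp add: q_def)
        qed
        moreover have "j \<noteq> length ys" using qp(2) lp(2) by (auto simp: q_def)
        moreover have "q = p \<otimes> (inv p \<otimes> q)" using p c by (simp add: m_assoc[symmetric])
        then have "len q \<le> i + m" using len_mult[of p "inv p \<otimes> q"] p c qp by simp
        moreover have "r = (inv q \<otimes> p) \<otimes> (inv p \<otimes> ?g)"
        proof -
          have "(inv q \<otimes> p) \<otimes> (inv p \<otimes> (q \<otimes> r)) = inv q \<otimes> (p \<otimes> inv p) \<otimes> q \<otimes> r"
            using p(1) c by (simp only: m_assoc inv_closed m_closed)
          also have "\<dots> = r" using p(1) c by simp
          finally show ?thesis by (simp add: g)
        qed
        then have "len r \<le> m + (len ?g - i)"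
          using len_mult[of "inv q \<otimes> p" "inv p \<otimes> ?g"] p c gG qp by simp
        ultimately show ?thesis
          using j L less.prems(1) by (intro split[of j]) (auto simp: q_def r_def i_def)
      qed
    qed
  qed
  then show "g \<in> T" using \<open>lprod ys = g\<close> by simp
qed

end

lemma (in tree_length) finitely_generated_inter:
  assumes "finitely_generated G H" "finitely_generated G K"
  shows "finitely_generated G (H \<inter> K)"
proof -
  obtain S T where S: "finite S" "S \<subseteq> carrier G" "H = generate G S"
    and T: "finite T" "T \<subseteq> carrier G" "K = generate G T"
    using assms by (auto simp: finitely_generated_def)
  define m where "m = Max (len ` (S \<union> T) \<union> {0})"
  have "S \<subseteq> ball m" "T \<subseteq> ball m"
    using S T by (auto simp: m_def intro!: Max_ge)
  then have "generate G (H \<inter> K \<inter> ball (2 * card (ball m) ^ 2)) = H \<inter> K" (is "generate G ?B = _")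
    unfolding S(3) T(3) by (rule inter_generated) simp
  then have "H \<inter> K = generate G ?B" by (rule HOL.sym)
  moreover have "finite ?B" "?B \<subseteq> carrier G" using finite_ball by auto
  ultimately show ?thesis unfolding finitely_generated_def by blast
qed

section \<open>The action of the factors on normal forms\<close>

locale amalgam =
  fixes Gr :: "'i \<Rightarrow> ('g, 'm) monoid_scheme" and A :: "('a, 'n) monoid_scheme" and \<phi> :: "'i \<Rightarrow> 'a \<Rightarrow> 'g"
  assumes factor_group: "\<And>i. group (Gr i)" and base_group: "group A"
    and emb: "\<And>i. \<phi> i \<in> mon A (Gr i)"
begin

lemma emb_hom: "\<phi> i \<in> hom A (Gr i)" and emb_inj: "inj_on (\<phi> i) (carrier A)"
  using emb[of i] by (auto simp: mon_def)

lemma emb_closed [simp, intro]: "a \<in> carrier A \<Longrightarrow> \<phi> i a \<in> carrier (Gr i)"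
  using emb_hom[of i] by (auto simp: hom_def)

lemma emb_mult: "a \<in> carrier A \<Longrightarrow> b \<in> carrier A \<Longrightarrow> \<phi> i (a \<otimes>\<^bsub>A\<^esub> b) = \<phi> i a \<otimes>\<^bsub>Gr i\<^esub> \<phi> i b"
  using emb_hom[of i] by (auto simp: hom_def)

lemma emb_one: "\<phi> i \<one>\<^bsub>A\<^esub> = \<one>\<^bsub>Gr i\<^esub>"
  using hom_one[OF emb_hom base_group factor_group] .

lemma emb_subgroup: "subgroup (\<phi> i ` carrier A) (Gr i)"
proof -
  interpret group_hom A "Gr i" "\<phi> i"
    by (simp add: group_hom_def group_hom_axioms_def factor_group base_group emb_hom)
  show ?thesis by (rule img_is_subgroup)
qed

abbreviation coset :: "'i \<Rightarrow> 'g \<Rightarrow> 'g set" where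
  "coset i x \<equiv> x <#\<^bsub>Gr i\<^esub> (\<phi> i ` carrier A)"

text \<open>Normal forms use one representative for each left coset of the embedded copy of \<open>A\<close>.  The coset
  of the unit gets the unit, which lets a syllable vanish when it falls into \<open>A\<close>.\<close>

definition rep :: "'i \<Rightarrow> 'g \<Rightarrow> 'g" where
  "rep i x = (if \<one>\<^bsub>Gr i\<^esub> \<in> coset i x then \<one>\<^bsub>Gr i\<^esub> else SOME t. t \<in> coset i x)"

definition tail :: "'i \<Rightarrow> 'g \<Rightarrow> 'a" where
  "tail i x = (SOME a. a \<in> carrier A \<and> x = rep i x \<otimes>\<^bsub>Gr i\<^esub> \<phi> i a)"

lemma coset_eq:
  assumes "x \<in> carrier (Gr i)" "a \<in> carrier A"
  shows "coset i (x \<otimes>\<^bsub>Gr i\<^esub> \<phi> i a) = coset i x"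
proof -
  interpret group "Gr i" by (rule factor_group)
  have "x \<otimes>\<^bsub>Gr i\<^esub> \<phi> i a \<in> coset i x" using assms by (auto simp: l_coset_def)
  then show ?thesis using l_repr_independence[OF _ assms(1) emb_subgroup] by simp
qed

lemma coset_elem:
  assumes "x \<in> carrier (Gr i)" "t \<in> coset i x"
  shows "t \<in> carrier (Gr i) \<and> (\<exists>a\<in>carrier A. x = t \<otimes>\<^bsub>Gr i\<^esub> \<phi> i a)"
proof -
  interpret group "Gr i" by (rule factor_group)
  obtain a where a: "a \<in> carrier A" "t = x \<otimes>\<^bsub>Gr i\<^esub> \<phi> i a"
    using assms by (auto simp: l_coset_def)
  have b: "inv\<^bsub>A\<^esub> a \<in> carrier A" using a base_group by simp
  have "x = x \<otimes>\<^bsub>Gr i\<^esub> \<phi> i (a \<otimes>\<^bsub>A\<^esub> inv\<^bsub>A\<^esub> a)"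
    using assms a base_group by (simp add: emb_one group.r_inv)
  also have "\<dots> = t \<otimes>\<^bsub>Gr i\<^esub> \<phi> i (inv\<^bsub>A\<^esub> a)" using assms a b by (simp add: emb_mult m_assoc)
  finally have "x = t \<otimes>\<^bsub>Gr i\<^esub> \<phi> i (inv\<^bsub>A\<^esub> a)" .
  moreover have "t \<in> carrier (Gr i)" using a assms by simp
  ultimately show ?thesis using b by auto
qed

lemma rep_in_coset:
  assumes "x \<in> carrier (Gr i)"
  shows "rep i x \<in> coset i x"
proof -
  interpret group "Gr i" by (rule factor_group)
  have "x = x \<otimes>\<^bsub>Gr i\<^esub> \<phi> i \<one>\<^bsub>A\<^esub>" using assms by (simp add: emb_one)
  moreover have "\<one>\<^bsub>A\<^esub> \<in> carrier A" by (simp add: base_group group.is_monoid)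
  ultimately have "x \<in> coset i x" unfolding l_coset_def by blast
  then show ?thesis unfolding rep_def by (auto intro: someI[of "\<lambda>t. t \<in> coset i x"])
qed

lemma rep_closed [simp, intro]: "x \<in> carrier (Gr i) \<Longrightarrow> rep i x \<in> carrier (Gr i)"
  using coset_elem rep_in_coset by blast

lemma tail: "x \<in> carrier (Gr i) \<Longrightarrow> tail i x \<in> carrier A \<and> x = rep i x \<otimes>\<^bsub>Gr i\<^esub> \<phi> i (tail i x)"
  unfolding tail_def by (rule someI_ex) (use coset_elem rep_in_coset in blast)

lemma rep_mult_emb: "x \<in> carrier (Gr i) \<Longrightarrow> a \<in> carrier A \<Longrightarrow> rep i (x \<otimes>\<^bsub>Gr i\<^esub> \<phi> i a) = rep i x"
  unfolding rep_def by (simp add: coset_eq)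

lemma rep_rep: "x \<in> carrier (Gr i) \<Longrightarrow> rep i (rep i x) = rep i x"
  using rep_mult_emb[of "rep i x" i "tail i x"] tail[of x i] by simp

lemma rep_emb: 
  assumes "a \<in> carrier A"
  shows "rep i (\<phi> i a) = \<one>\<^bsub>Gr i\<^esub>"
proof -
  interpret group "Gr i" by (rule factor_group)
  have "coset i (\<phi> i a) = \<phi> i ` carrier A"
    using coset_eq[of "\<one>\<^bsub>Gr i\<^esub>" i a] assms emb_subgroup[of i] by (simp add: lcos_mult_one subgroup.subset)
  then show ?thesis using emb_subgroup[of i] by (simp add: rep_def subgroup.one_closed)
qed

lemma tail_rep_mult:
  assumes "s \<in> carrier (Gr i)" "rep i s = s" "a \<in> carrier A"
  shows "tail i (s \<otimes>\<^bsub>Gr i\<^esub> \<phi> i a) = a"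
proof -
  interpret group "Gr i" by (rule factor_group)
  let ?x = "s \<otimes>\<^bsub>Gr i\<^esub> \<phi> i a"
  have t: "tail i ?x \<in> carrier A" "?x = s \<otimes>\<^bsub>Gr i\<^esub> \<phi> i (tail i ?x)"
    using tail[of ?x i] rep_mult_emb[of s i a] assms by auto
  then have "\<phi> i a = \<phi> i (tail i ?x)" using assms Units_l_cancel[of s "\<phi> i a" "\<phi> i (tail i ?x)"] by auto
  then show ?thesis using emb_inj[of i] t(1) assms(3) by (auto dest: inj_onD)
qed

definition symbols :: "('i \<times> 'g) set" where
  "symbols = {(i, s). s \<in> carrier (Gr i) \<and> rep i s = s \<and> s \<noteq> \<one>\<^bsub>Gr i\<^esub>}"

fun reduced :: "('i \<times> 'g) list \<Rightarrow> bool" where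
  "reduced (p # q # stk) \<longleftrightarrow> fst p \<noteq> fst q \<and> reduced (q # stk)"
| "reduced _ \<longleftrightarrow> True"

definition states :: "(('i \<times> 'g) list \<times> 'a) set" where
  "states = {(stk, a). set stk \<subseteq> symbols \<and> reduced stk \<and> a \<in> carrier A}"

text \<open>A state \<open>(stk, a)\<close> stands for the product of the syllables on the stack, from the bottom (the end of
  the list) to the top, followed by \<open>a\<close>.  To let factor \<open>i\<close> act, a state is written as a stack whose
  top does not belong to factor \<open>i\<close>, followed by a single element of that factor.  This is a
  bijection, so multiplication of that element on the right transfers to an action of factor \<open>i\<close> on
  states.\<close>

fun unpack :: "'i \<Rightarrow> ('i \<times> 'g) list \<times> 'a \<Rightarrow> ('i \<times> 'g) list \<times> 'g" where
  "unpack i ([], a) = ([], \<phi> i a)"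
| "unpack i ((j, s) # stk, a) = (if j = i then (stk, s \<otimes>\<^bsub>Gr i\<^esub> \<phi> i a) else ((j, s) # stk, \<phi> i a))"

definition pack :: "'i \<Rightarrow> ('i \<times> 'g) list \<times> 'g \<Rightarrow> ('i \<times> 'g) list \<times> 'a" where
  "pack i = (\<lambda>(stk, x). (if rep i x = \<one>\<^bsub>Gr i\<^esub> then stk else (i, rep i x) # stk, tail i x))"

definition act :: "'i \<Rightarrow> 'g \<Rightarrow> ('i \<times> 'g) list \<times> 'a \<Rightarrow> ('i \<times> 'g) list \<times> 'a" where
  "act i x st = (let (stk, y) = unpack i st in pack i (stk, y \<otimes>\<^bsub>Gr i\<^esub> x))"

definition unpacked :: "'i \<Rightarrow> (('i \<times> 'g) list \<times> 'g) set" where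
  "unpacked i = {(stk, x). set stk \<subseteq> symbols \<and> reduced stk \<and> (stk \<noteq> [] \<longrightarrow> fst (hd stk) \<noteq> i) \<and> x \<in> carrier (Gr i)}"

lemma reduced_ConsD: "reduced (p # stk) \<Longrightarrow> reduced stk \<and> (stk \<noteq> [] \<longrightarrow> fst (hd stk) \<noteq> fst p)"
  by (cases stk) auto

lemma unpack_in: 
  assumes "st \<in> states"
  shows "unpack i st \<in> unpacked i"
proof -
  interpret group "Gr i" by (rule factor_group)
  from assms show ?thesis
    by (cases "(i, st)" rule: unpack.cases)
      (auto simp: states_def unpacked_def symbols_def dest: reduced_ConsD)
qed

lemma pack_in: "u \<in> unpacked i \<Longrightarrow> pack i u \<in> states"
proof -
  assume u: "u \<in> unpacked i"
  obtain stk x where ux: "u = (stk, x)" by fastforce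
  have "reduced ((i, rep i x) # stk)" using u ux by (cases stk) (auto simp: unpacked_def)
  then show ?thesis using u ux tail[of x i] rep_rep[of x i]
    by (auto simp: unpacked_def pack_def states_def symbols_def)
qed

lemma pack_unpack:
  assumes "st \<in> states"
  shows "pack i (unpack i st) = st"
proof -
  interpret group "Gr i" by (rule factor_group)
  have "tail i (\<phi> i a) = a" if "a \<in> carrier A" for a
    using tail_rep_mult[of "\<one>\<^bsub>Gr i\<^esub>" i a] that rep_emb[of "\<one>\<^bsub>A\<^esub>" i] base_group
    by (simp add: emb_one group.is_monoid)
  with assms show ?thesis
    by (cases "(i, st)" rule: unpack.cases)
      (auto simp: states_def pack_def symbols_def rep_emb rep_mult_emb tail_rep_mult)
qed

lemma unpack_pack:
  assumes "u \<in> unpacked i"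
  shows "unpack i (pack i u) = u"
proof -
  interpret group "Gr i" by (rule factor_group)
  obtain stk x where u: "u = (stk, x)" by fastforce
  have x: "x \<in> carrier (Gr i)" using assms u by (simp add: unpacked_def)
  note t = tail[OF x]
  show ?thesis
  proof (cases "rep i x = \<one>\<^bsub>Gr i\<^esub>")
    case True
    then have "\<phi> i (tail i x) = x" using t by (metis emb_closed l_one)
    then show ?thesis using True assms u
      by (cases stk) (auto simp: pack_def unpacked_def)
  next
    case False
    then show ?thesis using t u by (simp add: pack_def)
  qed
qed

lemma act_in: "st \<in> states \<Longrightarrow> x \<in> carrier (Gr i) \<Longrightarrow> act i x st \<in> states"
proof -
  interpret group "Gr i" by (rule factor_group)
  show "st \<in> states \<Longrightarrow> x \<in> carrier (Gr i) \<Longrightarrow> act i x st \<in> states"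
    using unpack_in[of st i] unfolding act_def by (auto intro!: pack_in simp: unpacked_def)
qed

lemma act_mult:
  assumes "st \<in> states" "x \<in> carrier (Gr i)" "y \<in> carrier (Gr i)"
  shows "act i (x \<otimes>\<^bsub>Gr i\<^esub> y) st = act i y (act i x st)"
proof -
  interpret group "Gr i" by (rule factor_group)
  obtain stk z where u: "unpack i st = (stk, z)" by fastforce
  then have *: "(stk, z) \<in> unpacked i" using unpack_in[OF assms(1)] by metis
  then have "(stk, z \<otimes>\<^bsub>Gr i\<^esub> x) \<in> unpacked i" "z \<in> carrier (Gr i)" using assms by (auto simp: unpacked_def)
  then show ?thesis using assms u by (simp add: act_def unpack_pack m_assoc)
qed

lemma act_one: "st \<in> states \<Longrightarrow> act i \<one>\<^bsub>Gr i\<^esub> st = st"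
proof -
  interpret group "Gr i" by (rule factor_group)
  show "st \<in> states \<Longrightarrow> ?thesis"
    using pack_unpack[of st i] unpack_in[of st i] by (auto simp: act_def unpacked_def split: prod.splits)
qed

text \<open>An element of \<open>A\<close> acts in the same way in whichever factor it is taken; this is what lets the
  actions of the factors fit together.\<close>

lemma act_emb:
  assumes "(stk, a) \<in> states" "b \<in> carrier A"
  shows "act i (\<phi> i b) (stk, a) = (stk, a \<otimes>\<^bsub>A\<^esub> b)"
proof -
  interpret group "Gr i" by (rule factor_group)
  interpret A: group A by (rule base_group)
  have a: "a \<in> carrier A" using assms by (simp add: states_def)
  have st: "(stk, a \<otimes>\<^bsub>A\<^esub> b) \<in> states" using assms by (simp add: states_def)
  obtain stk' x where u: "unpack i (stk, a) = (stk', x)" by fastforce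
  have "unpack i (stk, a \<otimes>\<^bsub>A\<^esub> b) = (stk', x \<otimes>\<^bsub>Gr i\<^esub> \<phi> i b)"
    using u a assms by (cases "(i, (stk, a))" rule: unpack.cases)
      (auto simp: emb_mult m_assoc states_def symbols_def split: if_splits)
  then show ?thesis using pack_unpack[OF st, of i] u by (simp add: act_def)
qed

end

section \<open>The length of normal forms is tree-like\<close>

text \<open>A group \<open>G\<close> generated by the images of the factors, identified along \<open>A\<close>, together with an
  equivariant map from \<open>G\<close> to the states.  Such a map exists as soon as the actions of the factors
  extend to an action of \<open>G\<close>: it sends \<open>g\<close> to the image of the empty state under \<open>g\<close>.\<close>

locale amalgamated_product = amalgam Gr A \<phi> + group G
  for Gr :: "'i \<Rightarrow> ('g, 'm) monoid_scheme" and A :: "('a, 'n) monoid_scheme" and \<phi> :: "'i \<Rightarrow> 'a \<Rightarrow> 'g"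
    and G :: "('h, 'k) monoid_scheme" (structure) +
  fixes \<iota> :: "'i \<Rightarrow> 'g \<Rightarrow> 'h" and \<psi> :: "'a \<Rightarrow> 'h" and nf :: "'h \<Rightarrow> ('i \<times> 'g) list \<times> 'a"
  assumes incl_hom: "\<And>i. \<iota> i \<in> hom (Gr i) G"
    and incl_emb: "\<And>i a. a \<in> carrier A \<Longrightarrow> \<iota> i (\<phi> i a) = \<psi> a"
    and incl_generate: "\<And>g. g \<in> carrier G \<Longrightarrow>
      \<exists>ls. set ls \<subseteq> {(i, x). x \<in> carrier (Gr i)} \<and> g = foldl (\<lambda>g (i, x). g \<otimes> \<iota> i x) \<one> ls"
    and nf_one: "nf \<one> = ([], \<one>\<^bsub>A\<^esub>)"
    and nf_mult: "\<And>g i x. g \<in> carrier G \<Longrightarrow> x \<in> carrier (Gr i) \<Longrightarrow> nf (g \<otimes> \<iota> i x) = act i x (nf g)"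
    and finite_factor: "\<And>i. finite (carrier (Gr i))" and finite_index: "finite (UNIV :: 'i set)"
begin

lemma incl_closed [simp, intro]: "x \<in> carrier (Gr i) \<Longrightarrow> \<iota> i x \<in> carrier G"
  using incl_hom[of i] by (auto simp: hom_def)

lemma incl_mult: "x \<in> carrier (Gr i) \<Longrightarrow> y \<in> carrier (Gr i) \<Longrightarrow> \<iota> i (x \<otimes>\<^bsub>Gr i\<^esub> y) = \<iota> i x \<otimes> \<iota> i y"
  using incl_hom[of i] by (auto simp: hom_def)

lemma incl_one: "\<iota> i \<one>\<^bsub>Gr i\<^esub> = \<one>"
  using hom_one[OF incl_hom factor_group is_group] .

lemma base_closed [simp, intro]: "a \<in> carrier A \<Longrightarrow> \<psi> a \<in> carrier G"
  using incl_emb[of a undefined] emb_closed incl_closed by metis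

lemma base_one: "\<psi> \<one>\<^bsub>A\<^esub> = \<one>"
  using incl_emb[of "\<one>\<^bsub>A\<^esub>" undefined] emb_one incl_one base_group by (simp add: group.is_monoid)

lemma carrier_induct [consumes 1, case_names one mult]:
  assumes "g \<in> carrier G" "P \<one>"
    and "\<And>g i x. g \<in> carrier G \<Longrightarrow> x \<in> carrier (Gr i) \<Longrightarrow> P g \<Longrightarrow> P (g \<otimes> \<iota> i x)"
  shows "P g"
proof -
  obtain ls where ls: "set ls \<subseteq> {(i, x). x \<in> carrier (Gr i)}" "g = foldl (\<lambda>g (i, x). g \<otimes> \<iota> i x) \<one> ls"
    using incl_generate[OF assms(1)] by blast
  have "P (foldl (\<lambda>g (i, x). g \<otimes> \<iota> i x) \<one> ls) \<and> foldl (\<lambda>g (i, x). g \<otimes> \<iota> i x) \<one> ls \<in> carrier G"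
    using ls(1) by (induction ls rule: rev_induct) (auto simp: assms)
  then show ?thesis using ls by simp
qed

lemma nf_in: "g \<in> carrier G \<Longrightarrow> nf g \<in> states"
proof (induction rule: carrier_induct)
  case one
  then show ?case using base_group by (simp add: nf_one states_def group.is_monoid)
next
  case (mult g i x)
  then show ?case by (simp add: nf_mult act_in)
qed

fun stack_val :: "('i \<times> 'g) list \<Rightarrow> 'h" where
  "stack_val [] = \<one>"
| "stack_val ((i, s) # stk) = stack_val stk \<otimes> \<iota> i s"

lemma stack_val_closed [simp, intro]: "set stk \<subseteq> symbols \<Longrightarrow> stack_val stk \<in> carrier G"
  by (induction stk rule: stack_val.induct) (auto simp: symbols_def)

lemma stack_val_append: "set stk \<subseteq> symbols \<Longrightarrow> set stk' \<subseteq> symbols \<Longrightarrow>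
    stack_val (stk @ stk') = stack_val stk' \<otimes> stack_val stk"
  by (induction stk rule: stack_val.induct) (auto simp: symbols_def m_assoc)

lemma unpack_val:
  assumes "(stk, a) \<in> states" "unpack i (stk, a) = (stk', y)"
  shows "stack_val stk \<otimes> \<psi> a = stack_val stk' \<otimes> \<iota> i y"
  using assms by (cases "(i, (stk, a))" rule: unpack.cases)
    (auto simp: states_def symbols_def incl_mult incl_emb m_assoc split: if_splits)

lemma pack_val:
  assumes "(stk, y) \<in> unpacked i" "pack i (stk, y) = (stk', a)"
  shows "stack_val stk' \<otimes> \<psi> a = stack_val stk \<otimes> \<iota> i y"
proof -
  have c: "set stk \<subseteq> symbols" and y: "y \<in> carrier (Gr i)" using assms by (auto simp: unpacked_def)
  note t = tail[OF y]
  have "\<iota> i y = \<iota> i (rep i y) \<otimes> \<psi> (tail i y)"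
    using t incl_mult[of "rep i y" i "\<phi> i (tail i y)"] y incl_emb[of "tail i y" i] by auto
  then show ?thesis using assms(2) c t y incl_one[of i]
    by (auto simp: pack_def m_assoc split: if_splits)
qed

lemma act_val:
  assumes st: "(stk, a) \<in> states" and x: "x \<in> carrier (Gr i)" and eq: "act i x (stk, a) = (stk', a')"
  shows "stack_val stk' \<otimes> \<psi> a' = stack_val stk \<otimes> \<psi> a \<otimes> \<iota> i x"
proof -
  interpret Gi: group "Gr i" by (rule factor_group)
  obtain r y where u: "unpack i (stk, a) = (r, y)" by fastforce
  then have ry: "(r, y) \<in> unpacked i" using unpack_in[OF st, of i] by simp
  then have c: "stack_val r \<in> carrier G" "y \<in> carrier (Gr i)" by (auto simp: unpacked_def)
  have "(r, y \<otimes>\<^bsub>Gr i\<^esub> x) \<in> unpacked i" using ry x by (simp add: unpacked_def)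
  from pack_val[OF this] have "stack_val stk' \<otimes> \<psi> a' = stack_val r \<otimes> \<iota> i (y \<otimes>\<^bsub>Gr i\<^esub> x)"
    using eq u by (simp add: act_def)
  then show ?thesis using unpack_val[OF st u] c x by (simp add: incl_mult m_assoc)
qed

text \<open>Evaluating the normal form gives the element back.  In particular, normal forms decide equality in
  \<open>G\<close>.\<close>

lemma nf_val: "g \<in> carrier G \<Longrightarrow> nf g = (stk, a) \<Longrightarrow> stack_val stk \<otimes> \<psi> a = g"
proof (induction arbitrary: stk a rule: carrier_induct)
  case one
  then show ?case by (auto simp: nf_one base_one)
next
  case (mult g i x)
  obtain stk' a' where g: "nf g = (stk', a')" by fastforce
  then show ?case using mult act_val[of stk' a' x i stk a] nf_in[of g] nf_mult[of g x i] by simp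
qed

lemma inj_nf: "inj_on nf (carrier G)"
  by (rule inj_onI) (metis nf_val surj_pair)

definition stack :: "'h \<Rightarrow> ('i \<times> 'g) list" where "stack g = fst (nf g)"
definition len :: "'h \<Rightarrow> nat" where "len g = length (stack g)"
text \<open>The bottom \<open>i\<close> syllables of the stack.\<close>

definition pre :: "'h \<Rightarrow> nat \<Rightarrow> 'h" where "pre g i = stack_val (drop (len g - i) (stack g))"

lemma stack_symbols: "g \<in> carrier G \<Longrightarrow> set (stack g) \<subseteq> symbols"
  using nf_in[of g] by (auto simp: stack_def states_def)

lemma stack_mult_base: "g \<in> carrier G \<Longrightarrow> a \<in> carrier A \<Longrightarrow> stack (g \<otimes> \<psi> a) = stack g"
  using nf_in[of g] nf_mult[of g "\<phi> undefined a" undefined]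
  by (cases "nf g") (simp add: stack_def incl_emb act_emb)

text \<open>A multiplication by an element of a factor touches only the topmost syllable.\<close>

lemma stack_mult_incl:
  assumes "g \<in> carrier G" "x \<in> carrier (Gr i)"
  obtains n r where "stack (g \<otimes> \<iota> i x) = r @ drop n (stack g)" "n \<le> length (stack g)" "length r \<le> 1"
proof -
  obtain stk a where g: "nf g = (stk, a)" by fastforce
  obtain r y where u: "unpack i (stk, a) = (r, y)" by fastforce
  have "r = drop 0 stk \<or> stk \<noteq> [] \<and> r = drop 1 stk"
    using u by (cases "(i, (stk, a))" rule: unpack.cases) (auto split: if_splits)
  moreover have "\<exists>n\<le>length stk. drop m stk = drop n stk" for m
    by (cases "m \<le> length stk") auto
  ultimately obtain n where n: "n \<le> length stk" "r = drop n stk" by metis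
  have "stack (g \<otimes> \<iota> i x) = r \<or> (\<exists>p. stack (g \<otimes> \<iota> i x) = [p] @ r)"
    using u g nf_mult[OF assms] by (auto simp: stack_def act_def pack_def)
  then have "\<exists>r'. stack (g \<otimes> \<iota> i x) = r' @ r \<and> length r' \<le> 1"
    by (elim disjE exE) (rule exI[of _ "[]"], simp, rule exI, rule conjI, assumption, simp)
  then obtain r' where "stack (g \<otimes> \<iota> i x) = r' @ r" "length r' \<le> 1" by blast
  then show ?thesis using n g by (intro that[of r' n]) (simp_all add: stack_def)
qed

lemma len_mult_incl: "g \<in> carrier G \<Longrightarrow> x \<in> carrier (Gr i) \<Longrightarrow> len (g \<otimes> \<iota> i x) \<le> len g + 1"
  by (rule stack_mult_incl[of g x i]) (auto simp: len_def)

lemma len_mult_base: "g \<in> carrier G \<Longrightarrow> a \<in> carrier A \<Longrightarrow> len (g \<otimes> \<psi> a) = len g"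
  by (simp add: len_def stack_mult_base)

lemma len_mult_stack_val:
  "g \<in> carrier G \<Longrightarrow> set stk \<subseteq> symbols \<Longrightarrow> len (g \<otimes> stack_val stk) \<le> len g + length stk"
proof (induction stk rule: stack_val.induct)
  case (2 i s stk)
  then have s: "s \<in> carrier (Gr i)" by (auto simp: symbols_def)
  have "len (g \<otimes> stack_val stk \<otimes> \<iota> i s) \<le> len (g \<otimes> stack_val stk) + 1"
    using 2 s by (intro len_mult_incl) auto
  then show ?case using 2 s by (simp add: m_assoc)
qed simp

lemma len_mult_inv_stack_val:
  "g \<in> carrier G \<Longrightarrow> set stk \<subseteq> symbols \<Longrightarrow> len (g \<otimes> inv (stack_val stk)) \<le> len g + length stk"
proof (induction stk arbitrary: g rule: stack_val.induct)
  case (2 i s stk)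
  interpret Gi: group "Gr i" by (rule factor_group)
  interpret h: group_hom "Gr i" G "\<iota> i"
    by unfold_locales (rule incl_hom)
  have s: "s \<in> carrier (Gr i)" using 2 by (auto simp: symbols_def)
  have "len (g \<otimes> \<iota> i (inv\<^bsub>Gr i\<^esub> s) \<otimes> inv (stack_val stk)) \<le> len (g \<otimes> \<iota> i (inv\<^bsub>Gr i\<^esub> s)) + length stk"
    using 2 s by (intro 2) auto
  also have "\<dots> \<le> len g + 1 + length stk" using 2 s len_mult_incl[of g "inv\<^bsub>Gr i\<^esub> s" i] by simp
  finally show ?case using 2 s by (simp add: m_assoc inv_mult_group)
qed (simp add: len_def)

lemma decompose:
  assumes "g \<in> carrier G"
  obtains a where "a \<in> carrier A" "g = stack_val (stack g) \<otimes> \<psi> a" "set (stack g) \<subseteq> symbols"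
  using nf_in[OF assms] nf_val[OF assms] by (cases "nf g") (auto simp: stack_def states_def)

lemma len_one: "len \<one> = 0"
  by (simp add: len_def stack_def nf_one)

lemma len_mult:
  assumes "g \<in> carrier G" "h \<in> carrier G"
  shows "len (g \<otimes> h) \<le> len g + len h"
proof -
  obtain a where a: "a \<in> carrier A" "h = stack_val (stack h) \<otimes> \<psi> a" "set (stack h) \<subseteq> symbols"
    using decompose[OF assms(2)] .
  have "g \<otimes> h = g \<otimes> stack_val (stack h) \<otimes> \<psi> a"
    using a assms by (metis base_closed m_assoc stack_val_closed)
  then show ?thesis using a assms
    by (simp add: len_mult_base len_mult_stack_val len_def[of h])
qed

lemma len_inv:
  assumes "g \<in> carrier G"
  shows "len (inv g) \<le> len g"
proof -
  obtain a where a: "a \<in> carrier A" "g = stack_val (stack g) \<otimes> \<psi> a" "set (stack g) \<subseteq> symbols"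
    using decompose[OF assms] .
  interpret A: group A by (rule base_group)
  have "\<psi> a \<otimes> \<psi> (inv\<^bsub>A\<^esub> a) = \<one>"
    using a emb_mult[of a "inv\<^bsub>A\<^esub> a" undefined] incl_mult[of "\<phi> undefined a" undefined "\<phi> undefined (inv\<^bsub>A\<^esub> a)"]
    by (metis A.inv_closed A.r_inv incl_emb emb_closed emb_one incl_one)
  then have inv: "inv (\<psi> a) = \<psi> (inv\<^bsub>A\<^esub> a)" using a by (metis A.inv_closed base_closed inv_equality inv_inv inv_comm)
  have "inv g = inv (\<psi> a) \<otimes> inv (stack_val (stack g))" using a by (metis base_closed inv_mult_group stack_val_closed)
  then have "inv g = \<one> \<otimes> \<psi> (inv\<^bsub>A\<^esub> a) \<otimes> inv (stack_val (stack g))" using inv a by simp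
  then show ?thesis
    using len_mult_inv_stack_val[of "\<one> \<otimes> \<psi> (inv\<^bsub>A\<^esub> a)" "stack g"] a len_mult_base[of \<one> "inv\<^bsub>A\<^esub> a"] len_one
    by (simp add: len_def[of g])
qed

lemma finite_symbols: "finite symbols"
proof -
  have "symbols \<subseteq> Sigma UNIV (\<lambda>i. carrier (Gr i))" by (auto simp: symbols_def)
  then show ?thesis using finite_index finite_factor by (metis finite_SigmaI finite_subset)
qed

lemma finite_base: "finite (carrier A)"
  using emb_inj[of undefined] finite_factor[of undefined] emb_closed[of _ undefined]
  by (metis finite_imageD finite_subset image_subsetI)

text \<open>An explicit bound, since the algorithm has to compute one.\<close>

lemma ball_bound:
  "finite {g \<in> carrier G. len g \<le> n}"
  "card {g \<in> carrier G. len g \<le> n} \<le> (card symbols + 1) ^ n * card (carrier A)"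
proof -
  let ?B = "{g \<in> carrier G. len g \<le> n}" and ?L = "{stk. set stk \<subseteq> symbols \<and> length stk \<le> n}"
  have sub: "nf ` ?B \<subseteq> ?L \<times> carrier A"
    using nf_in by (force simp: states_def len_def stack_def)
  have L: "finite ?L" using finite_lists_length_le[OF finite_symbols] .
  have inj: "inj_on nf ?B" using inj_nf by (rule inj_on_subset) auto
  show "finite ?B"
    using finite_imageD[OF finite_subset[OF sub] inj] L finite_base by simp
  have "card ?B \<le> card ?L * card (carrier A)"
    using card_inj_on_le[OF inj sub] L finite_base by (simp add: card_cartesian_product)
  also have "card ?L \<le> (card symbols + 1) ^ n"
  proof -
    have "(\<Sum>i\<le>n. k ^ i) \<le> (k + 1) ^ n" for k :: nat
    proof (induction n)
      case (Suc n)
      have "k ^ n \<le> (k + 1) ^ n" by (rule power_mono) auto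
      then have "k * k ^ n \<le> k * (k + 1) ^ n" by (rule mult_le_mono2)
      then show ?case using Suc by (simp only: sum.atMost_Suc power_Suc add_mult_distrib mult_1)
    qed simp
    then show ?thesis by (simp add: card_lists_length_le[OF finite_symbols])
  qed
  finally show "card ?B \<le> (card symbols + 1) ^ n * card (carrier A)" by simp
qed

text \<open>If the new stack is at least \<open>i\<close> high, its bottom \<open>i\<close> syllables either have not been touched or
  they are the whole of it.\<close>

lemma pre_mult_incl:
  assumes "g \<in> carrier G" "x \<in> carrier (Gr k)" "i \<le> len (g \<otimes> \<iota> k x)"
  shows "i \<le> len g \<and> pre (g \<otimes> \<iota> k x) i = pre g i \<or> i = len (g \<otimes> \<iota> k x)"
proof (rule stack_mult_incl[OF assms(1,2)])
  fix n r assume s: "stack (g \<otimes> \<iota> k x) = r @ drop n (stack g)" "n \<le> length (stack g)" "length r \<le> 1"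
  show ?thesis
  proof (cases "i \<le> len g - n")
    case True
    then have "length r + (len g - n) - i = length r + (len g - n - i)" "len g - n - i + n = len g - i"
      using s(2) by (auto simp: len_def)
    then have "drop (length r + (len g - n) - i) (r @ drop n (stack g)) = drop (len g - i) (stack g)"
      by simp
    then have "pre (g \<otimes> \<iota> k x) i = pre g i"
      using s by (simp add: pre_def len_def)
    moreover have "i \<le> len g" using True by linarith
    ultimately show ?thesis by blast
  next
    case False
    then show ?thesis using assms(3) s by (auto simp: len_def)
  qed
qed

lemma pre_mult_base: "g \<in> carrier G \<Longrightarrow> a \<in> carrier A \<Longrightarrow> pre (g \<otimes> \<psi> a) i = pre g i"
  by (simp add: pre_def len_def stack_mult_base)

lemma pre_closed: "g \<in> carrier G \<Longrightarrow> pre g i \<in> carrier G"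
  using stack_symbols[of g] set_drop_subset[of "len g - i" "stack g"] unfolding pre_def by (intro stack_val_closed) auto

lemma len_mult_pre_len:
  assumes "g \<in> carrier G" "h \<in> carrier G"
  shows "len (h \<otimes> pre g (len g)) = len (h \<otimes> g)"
proof -
  obtain a where a: "a \<in> carrier A" "g = stack_val (stack g) \<otimes> \<psi> a" "set (stack g) \<subseteq> symbols"
    using decompose[OF assms(1)] .
  have "len (h \<otimes> stack_val (stack g) \<otimes> \<psi> a) = len (h \<otimes> stack_val (stack g))"
    using a assms by (intro len_mult_base) auto
  then show ?thesis using a assms by (simp add: pre_def m_assoc)
qed

text \<open>Multiply by the syllables one at a time.  A prefix of the final stack that is not an old one was the
  whole stack after some of the steps, and hence equals, up to an element of \<open>A\<close>, the product of \<open>g\<close>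
  with the syllables read so far.\<close>

lemma pre_mult_stack_val:
  assumes "g \<in> carrier G" "set stk \<subseteq> symbols" "i \<le> len (g \<otimes> stack_val stk)"
  shows "i \<le> len g \<and> pre (g \<otimes> stack_val stk) i = pre g i \<or>
    len (inv g \<otimes> pre (g \<otimes> stack_val stk) i) \<le> length stk"
  using assms
proof (induction stk rule: stack_val.induct)
  case (2 k s stk)
  let ?v = "stack_val stk"
  have s: "s \<in> carrier (Gr k)" and v: "?v \<in> carrier G" using 2 by (auto simp: symbols_def)
  have eq: "g \<otimes> stack_val ((k, s) # stk) = (g \<otimes> ?v) \<otimes> \<iota> k s" using 2 s v by (simp add: m_assoc)
  from pre_mult_incl[of "g \<otimes> ?v" s k i]
  consider "i \<le> len (g \<otimes> ?v)" "pre (g \<otimes> ?v \<otimes> \<iota> k s) i = pre (g \<otimes> ?v) i" | "i = len (g \<otimes> ?v \<otimes> \<iota> k s)"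
    using 2 s v eq by auto
  then show ?case
  proof cases
    case 1
    then show ?thesis using 2 eq by auto
  next
    case 2
    have "len (inv g \<otimes> pre (g \<otimes> ?v \<otimes> \<iota> k s) i) = len (inv g \<otimes> (g \<otimes> ?v \<otimes> \<iota> k s))"
      unfolding 2 using assms(1) s v by (intro len_mult_pre_len) auto
    also have "inv g \<otimes> (g \<otimes> ?v \<otimes> \<iota> k s) = stack_val ((k, s) # stk)"
      using assms(1) s v by (simp add: m_assoc[symmetric])
    also have "len \<dots> \<le> length ((k, s) # stk)"
      using len_mult_stack_val[of \<one> "(k, s) # stk"] \<open>set ((k, s) # stk) \<subseteq> symbols\<close>
        stack_val_closed[of "(k, s) # stk"] len_one by simp
    finally show ?thesis using eq by simp
  qed
qed simp

lemma len_stack_val: "set stk \<subseteq> symbols \<Longrightarrow> len (stack_val stk) \<le> length stk"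
  using len_mult_stack_val[of \<one> stk] len_one by simp

sublocale tree_length G len pre
proof
  show "len \<one> = 0" by (rule len_one)
next
  fix g h assume g: "g \<in> carrier G" and h: "h \<in> carrier G"
  show "len (g \<otimes> h) \<le> len g + len h" using g h by (rule len_mult)
  fix i assume i: "i \<le> len (g \<otimes> h)"
  obtain a where a: "a \<in> carrier A" "h = stack_val (stack h) \<otimes> \<psi> a" "set (stack h) \<subseteq> symbols"
    using decompose[OF h] .
  then have eq: "g \<otimes> h = g \<otimes> stack_val (stack h) \<otimes> \<psi> a" using g by (metis base_closed m_assoc stack_val_closed)
  have c: "g \<otimes> stack_val (stack h) \<in> carrier G" using g a by auto
  show "i \<le> len g \<and> pre (g \<otimes> h) i = pre g i \<or> len (inv g \<otimes> pre (g \<otimes> h) i) \<le> len h"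
    using pre_mult_stack_val[OF g a(3), of i] i c a(1)
    unfolding eq pre_mult_base[OF c a(1)] len_mult_base[OF c a(1)] by (simp add: len_def[of h])
next
  fix g assume g: "g \<in> carrier G"
  show "len (inv g) \<le> len g" using g by (rule len_inv)
  fix i assume i: "i \<le> len g"
  show "pre g i \<in> carrier G" using g by (rule pre_closed)
  obtain a where a: "a \<in> carrier A" "g = stack_val (stack g) \<otimes> \<psi> a" "set (stack g) \<subseteq> symbols"
    using decompose[OF g] .
  define n where "n = len g - i"
  have sub: "set (drop n (stack g)) \<subseteq> symbols" "set (take n (stack g)) \<subseteq> symbols"
    using a(3) set_drop_subset[of n "stack g"] set_take_subset[of n "stack g"] by auto
  show "len (pre g i) \<le> i"
    using len_stack_val[OF sub(1)] i by (simp add: pre_def n_def len_def)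
  have "stack_val (stack g) = pre g i \<otimes> stack_val (take n (stack g))"
    using stack_val_append[OF sub(2,1)] by (simp add: pre_def n_def)
  then have "g = pre g i \<otimes> (stack_val (take n (stack g)) \<otimes> \<psi> a)"
    using a sub pre_closed[OF g] by (metis base_closed m_assoc stack_val_closed)
  then have "inv (pre g i) \<otimes> g = stack_val (take n (stack g)) \<otimes> \<psi> a"
    using a sub pre_closed[OF g, of i] g by (metis base_closed inv_solve_left' m_closed stack_val_closed)
  then show "len (inv (pre g i) \<otimes> g) \<le> len g - i"
    using len_stack_val[OF sub(2)] len_mult_base[of "stack_val (take n (stack g))" a] sub a
    by (simp add: n_def)
next
  show "finite {g \<in> carrier G. len g \<le> n}" for n by (rule ball_bound)
qed

end

section \<open>Computable functions of one natural number\<close>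

text \<open>The class of recursive functions is not closed under changing values at lists of the wrong length,
  so closure properties are stated for functions that are recursive up to such changes.\<close>

definition recfn :: "nat \<Rightarrow> (nat list \<Rightarrow> nat) \<Rightarrow> bool" where
  "recfn k f \<longleftrightarrow> (\<exists>F. recursive k F \<and> (\<forall>xs. length xs = k \<longrightarrow> F xs = f xs))"

lemma recfn_cong: "recfn k f \<Longrightarrow> (\<And>xs. length xs = k \<Longrightarrow> f xs = g xs) \<Longrightarrow> recfn k g"
  unfolding recfn_def by metis

lemma recfn_const: "recfn k (\<lambda>xs. c)"
proof (induction c)
  case 0
  show ?case unfolding recfn_def using recursive.zero by blast
next
  case (Suc c)
  then obtain F where F: "recursive k F" "\<And>xs. length xs = k \<Longrightarrow> F xs = c"
    unfolding recfn_def by blast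
  have "recursive k (\<lambda>xs. (\<lambda>ys. Suc (hd ys)) (map (\<lambda>g. g xs) [F]))"
    by (rule recursive.comp) (use F recursive.succ in auto)
  then show ?case unfolding recfn_def using F by auto
qed

lemma recfn_nth: "i < k \<Longrightarrow> recfn k (\<lambda>xs. xs ! i)"
  unfolding recfn_def using recursive.proj by blast

lemma recfn_comp1:
  assumes "recfn 1 f" "recfn k g"
  shows "recfn k (\<lambda>xs. f [g xs])"
proof -
  obtain F G where F: "recursive 1 F" "\<And>xs. length xs = 1 \<Longrightarrow> F xs = f xs"
    and G: "recursive k G" "\<And>xs. length xs = k \<Longrightarrow> G xs = g xs"
    using assms unfolding recfn_def by blast
  have "recursive k (\<lambda>xs. F (map (\<lambda>g. g xs) [G]))"
    by (rule recursive.comp) (use F G in auto)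
  then show ?thesis unfolding recfn_def using F G by (intro exI conjI) auto
qed

lemma recfn_comp2:
  assumes "recfn 2 f" "recfn k g" "recfn k h"
  shows "recfn k (\<lambda>xs. f [g xs, h xs])"
proof -
  obtain F G H where F: "recursive 2 F" "\<And>xs. length xs = 2 \<Longrightarrow> F xs = f xs"
    and G: "recursive k G" "\<And>xs. length xs = k \<Longrightarrow> G xs = g xs"
    and H: "recursive k H" "\<And>xs. length xs = k \<Longrightarrow> H xs = h xs"
    using assms unfolding recfn_def by blast
  have "recursive k (\<lambda>xs. F (map (\<lambda>g. g xs) [G, H]))"
    by (rule recursive.comp) (use F G H in \<open>auto simp: numeral_2_eq_2\<close>)
  then show ?thesis unfolding recfn_def using F G H by (intro exI conjI) auto
qed

lemma recfn_Suc: "recfn k g \<Longrightarrow> recfn k (\<lambda>xs. Suc (g xs))"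
  using recfn_comp1[of "\<lambda>xs. Suc (hd xs)" k g] recursive.succ unfolding recfn_def by auto

lemma recfn_rec_nat:
  assumes "recfn k f" "recfn (Suc (Suc k)) g"
  shows "recfn (Suc k) (\<lambda>xs. rec_nat (f (tl xs)) (\<lambda>n r. g (n # r # tl xs)) (hd xs))"
proof -
  obtain F G where F: "recursive k F" "\<And>xs. length xs = k \<Longrightarrow> F xs = f xs"
    and G: "recursive (Suc (Suc k)) G" "\<And>xs. length xs = Suc (Suc k) \<Longrightarrow> G xs = g xs"
    using assms unfolding recfn_def by blast
  have "rec_nat (F (tl xs)) (\<lambda>n r. G (n # r # tl xs)) (hd xs) =
      rec_nat (f (tl xs)) (\<lambda>n r. g (n # r # tl xs)) (hd xs)" if "length xs = Suc k" for xs
    using F(2)[of "tl xs"] G(2)[of "_ # _ # tl xs"] that by simp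
  then show ?thesis unfolding recfn_def using recursive.prim_rec[OF F(1) G(1)] by blast
qed

lemma recfn_LEAST:
  assumes "recfn (Suc k) f" "\<And>xs. length xs = k \<Longrightarrow> \<exists>y. f (y # xs) = 0"
  shows "recfn k (\<lambda>xs. LEAST y. f (y # xs) = 0)"
proof -
  obtain F where F: "recursive (Suc k) F" "\<And>xs. length xs = Suc k \<Longrightarrow> F xs = f xs"
    using assms unfolding recfn_def by blast
  have "recursive k (\<lambda>xs. LEAST y. F (y # xs) = 0)"
    by (rule recursive.minimize) (use F assms in auto)
  then show ?thesis unfolding recfn_def using F by (intro exI conjI) auto
qed

lemma recfn_pred: "recfn k f \<Longrightarrow> recfn k (\<lambda>xs. f xs - 1)"
proof -
  have "recfn (Suc 0) (\<lambda>xs. rec_nat 0 (\<lambda>n r. (n # r # tl xs) ! 0) (hd xs))"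
    by (rule recfn_rec_nat[of 0 "\<lambda>_. 0"]) (auto intro: recfn_const recfn_nth)
  moreover have "rec_nat 0 (\<lambda>n r. (n # r # ys) ! 0) x = x - 1" for x :: nat and ys
    by (cases x) auto
  ultimately have "recfn 1 (\<lambda>xs. hd xs - 1)" by simp
  from recfn_comp1[OF this, of k f] show "recfn k f \<Longrightarrow> ?thesis" by simp
qed

lemma recfn_add: "recfn k f \<Longrightarrow> recfn k g \<Longrightarrow> recfn k (\<lambda>xs. f xs + g xs)"
proof -
  have "recfn (Suc 1) (\<lambda>xs. rec_nat (tl xs ! 0) (\<lambda>n r. Suc ((n # r # tl xs) ! 1)) (hd xs))"
    by (rule recfn_rec_nat[of 1 "\<lambda>xs. xs ! 0"]) (auto intro!: recfn_Suc recfn_nth)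
  moreover have "rec_nat y (\<lambda>n r. Suc r) x = x + y" for x y :: nat
    by (induction x) auto
  ultimately have "recfn 2 (\<lambda>xs. hd xs + tl xs ! 0)" by (simp add: numeral_2_eq_2)
  from recfn_comp2[OF this, of k f g] show "recfn k f \<Longrightarrow> recfn k g \<Longrightarrow> ?thesis" by simp
qed

lemma recfn_diff: "recfn k f \<Longrightarrow> recfn k g \<Longrightarrow> recfn k (\<lambda>xs. f xs - g xs)"
proof -
  have "recfn (Suc 1) (\<lambda>xs. rec_nat (tl xs ! 0) (\<lambda>n r. (n # r # tl xs) ! 1 - 1) (hd xs))"
    by (rule recfn_rec_nat[of 1 "\<lambda>xs. xs ! 0"]) (auto intro!: recfn_pred[unfolded One_nat_def] recfn_nth)
  moreover have "rec_nat y (\<lambda>n r. r - Suc 0) x = y - x" for x y :: nat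
    by (induction x) auto
  ultimately have "recfn 2 (\<lambda>xs. tl xs ! 0 - hd xs)" by (simp add: numeral_2_eq_2)
  from recfn_comp2[OF this, of k g f] show "recfn k f \<Longrightarrow> recfn k g \<Longrightarrow> ?thesis" by simp
qed

lemma recfn_triangle: "recfn k f \<Longrightarrow> recfn k (\<lambda>xs. triangle (f xs))"
proof -
  have "recfn (Suc 0) (\<lambda>xs. rec_nat 0 (\<lambda>n r. (n # r # tl xs) ! 1 + Suc ((n # r # tl xs) ! 0)) (hd xs))"
    by (rule recfn_rec_nat[of 0 "\<lambda>xs. 0"]) (auto intro!: recfn_const recfn_add recfn_Suc recfn_nth)
  moreover have "rec_nat 0 (\<lambda>n r. r + Suc n) x = triangle x" for x :: nat
    by (induction x) auto
  ultimately have "recfn 1 (\<lambda>xs. triangle (hd xs))" by simp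
  from recfn_comp1[OF this, of k f] show "recfn k f \<Longrightarrow> ?thesis" by simp
qed

text \<open>The Cantor pairing and its projections reduce functions of several arguments to unary ones, which
  are easier to compose.\<close>

abbreviation pair :: "nat \<Rightarrow> nat \<Rightarrow> nat" where "pair x y \<equiv> prod_encode (x, y)"
definition pfst :: "nat \<Rightarrow> nat" where "pfst z = fst (prod_decode z)"
definition psnd :: "nat \<Rightarrow> nat" where "psnd z = snd (prod_decode z)"

lemma pfst_psnd_pair [simp]: "pfst (pair x y) = x" "psnd (pair x y) = y"
  by (simp_all add: pfst_def psnd_def)

lemma recfn_pair: "recfn k f \<Longrightarrow> recfn k g \<Longrightarrow> recfn k (\<lambda>xs. pair (f xs) (g xs))"
  unfolding prod_encode_def by (auto intro!: recfn_add recfn_triangle)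

lemma triangle_mono: "i \<le> j \<Longrightarrow> triangle i \<le> triangle j"
  by (induction j rule: dec_induct) auto

lemma le_triangle: "n \<le> triangle n"
  by (induction n) auto

text \<open>The number \<open>pair x y\<close> lies between the triangular numbers of \<open>x + y\<close> and of \<open>x + y + 1\<close>, so a search
  among the triangular numbers recovers \<open>x + y\<close>.\<close>

lemma
  fixes z
  defines "t \<equiv> LEAST k. Suc z - triangle (Suc k) = 0"
  shows pfst_eq: "pfst z = z - triangle t" and psnd_eq: "psnd z = t - (z - triangle t)"
proof -
  obtain x y where z: "z = pair x y" by (metis prod_decode_inverse surj_pair)
  have "t = x + y"
    unfolding t_def
  proof (rule Least_equality)
    show "Suc z - triangle (Suc (x + y)) = 0" by (simp add: z prod_encode_def)
    fix k assume k: "Suc z - triangle (Suc k) = 0"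
    show "x + y \<le> k"
    proof (rule ccontr)
      assume "\<not> x + y \<le> k"
      then have "triangle (Suc k) \<le> triangle (x + y)" by (intro triangle_mono) simp
      with k show False by (simp add: z prod_encode_def)
    qed
  qed
  then show "pfst z = z - triangle t" "psnd z = t - (z - triangle t)"
    by (simp_all add: z, simp_all add: prod_encode_def)
qed

lemma recfn_pfst: "recfn k f \<Longrightarrow> recfn k (\<lambda>xs. pfst (f xs))"
  and recfn_psnd: "recfn k f \<Longrightarrow> recfn k (\<lambda>xs. psnd (f xs))"
proof -
  have t: "recfn 1 (\<lambda>xs. LEAST k. Suc ((k # xs) ! 1) - triangle (Suc ((k # xs) ! 0)) = 0)"
    (is "recfn 1 ?t")
  proof (rule recfn_LEAST)
    show "recfn (Suc 1) (\<lambda>xs. Suc (xs ! 1) - triangle (Suc (xs ! 0)))"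
      by (intro recfn_diff recfn_triangle recfn_Suc recfn_nth) auto
    show "\<exists>y. Suc ((y # xs) ! 1) - triangle (Suc ((y # xs) ! 0)) = 0" for xs
      using le_triangle[of "Suc ((0 # xs) ! 1)"] by (intro exI[of _ "(0 # xs) ! 1"]) simp
  qed
  have 1: "recfn 1 (\<lambda>xs. xs ! 0 - triangle (?t xs))" and "recfn 1 (\<lambda>xs. ?t xs - (xs ! 0 - triangle (?t xs)))"
    by (intro recfn_diff recfn_triangle recfn_nth t; simp)+
  then have "recfn 1 (\<lambda>xs. pfst (xs ! 0))" "recfn 1 (\<lambda>xs. psnd (xs ! 0))"
    by (auto elim!: recfn_cong simp: pfst_eq psnd_eq)
  from this[THEN recfn_comp1, of k f]
  show "recfn k f \<Longrightarrow> recfn k (\<lambda>xs. pfst (f xs))" "recfn k f \<Longrightarrow> recfn k (\<lambda>xs. psnd (f xs))" by simp_all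
qed

definition computable :: "(nat \<Rightarrow> nat) \<Rightarrow> bool" where
  "computable f \<longleftrightarrow> recfn 1 (\<lambda>xs. f (xs ! 0))"

lemma computable_comp: "computable f \<Longrightarrow> computable g \<Longrightarrow> computable (\<lambda>x. f (g x))"
  unfolding computable_def using recfn_comp1[of "\<lambda>xs. f (xs ! 0)" 1 "\<lambda>xs. g (xs ! 0)"] by simp

lemma computable_recfn: "computable f \<Longrightarrow> recfn k g \<Longrightarrow> recfn k (\<lambda>xs. f (g xs))"
  unfolding computable_def using recfn_comp1[of "\<lambda>xs. f (xs ! 0)" k g] by simp

text \<open>The rules below follow the structure of a term in one variable, so that the computability of an
  explicit term is proved by applying them repeatedly.  A term under a binder becomes a function of
  the pair of the outer variable and the bound one.\<close>

named_theorems computability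

lemma computable_id [computability]: "computable (\<lambda>x. x)"
  unfolding computable_def by (rule recfn_nth) simp

lemma computable_const [computability]: "computable (\<lambda>x. c)"
  unfolding computable_def by (rule recfn_const)

lemma computable_basic [computability]:
  assumes "computable f"
  shows "computable (\<lambda>x. pfst (f x))" "computable (\<lambda>x. psnd (f x))" "computable (\<lambda>x. Suc (f x))"
  using assms unfolding computable_def by (auto intro: recfn_pfst recfn_psnd recfn_Suc)

lemma computable_arith [computability]:
  assumes "computable f" "computable g"
  shows "computable (\<lambda>x. f x + g x)" "computable (\<lambda>x. f x - g x)" "computable (\<lambda>x. pair (f x) (g x))"
  using assms unfolding computable_def by (auto intro: recfn_add recfn_diff recfn_pair)

lemma computable_rec_nat [computability]:
  assumes b: "computable b" and f: "computable f"
    and g: "computable (\<lambda>z. g (pfst z) (pfst (psnd z)) (psnd (psnd z)))"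
  shows "computable (\<lambda>x. rec_nat (f x) (g x) (b x))"
proof -
  have "recfn (Suc 1) (\<lambda>xs. rec_nat ((\<lambda>xs. f (xs ! 0)) (tl xs))
      (\<lambda>n r. (\<lambda>ys. g (ys ! 2) (ys ! 0) (ys ! 1)) (n # r # tl xs)) (hd xs))"
  proof (rule recfn_rec_nat)
    show "recfn 1 (\<lambda>xs. f (xs ! 0))" using f by (simp add: computable_def)
    have "recfn (Suc (Suc 1)) (\<lambda>ys. pair (ys ! 2) (pair (ys ! 0) (ys ! 1)))"
      by (intro recfn_pair recfn_nth) auto
    from computable_recfn[OF g this]
    show "recfn (Suc (Suc 1)) (\<lambda>ys. g (ys ! 2) (ys ! 0) (ys ! 1))" by simp
  qed
  then have "recfn 2 (\<lambda>xs. rec_nat (f (tl xs ! 0)) (g (tl xs ! 0)) (hd xs))"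
    by (simp add: numeral_2_eq_2)
  from recfn_comp2[OF this, of 1 "\<lambda>xs. b (xs ! 0)" "\<lambda>xs. xs ! 0"] b
  show ?thesis by (simp add: computable_def recfn_nth)
qed

definition decidable :: "(nat \<Rightarrow> bool) \<Rightarrow> bool" where
  "decidable P \<longleftrightarrow> computable (\<lambda>x. of_bool (P x))"

lemma computable_if [computability]:
  assumes "decidable P" "computable f" "computable g"
  shows "computable (\<lambda>x. if P x then f x else g x)"
proof -
  have "computable (\<lambda>x. rec_nat (g x) (\<lambda>n r. f x) (of_bool (P x)))"
    by (intro computability computable_comp[OF assms(2)] assms assms(1)[unfolded decidable_def])
  moreover have "rec_nat (g x) (\<lambda>n r. f x) (of_bool (P x)) = (if P x then f x else g x)" for x
    by simp
  ultimately show ?thesis by simp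
qed

lemma decidable_comp: "decidable P \<Longrightarrow> computable f \<Longrightarrow> decidable (\<lambda>x. P (f x))"
  unfolding decidable_def by (rule computable_comp)

lemma decidable_logic [computability]:
  assumes "decidable P" "decidable Q"
  shows "decidable (\<lambda>x. P x \<and> Q x)" "decidable (\<lambda>x. P x \<or> Q x)" "decidable (\<lambda>x. P x \<longrightarrow> Q x)"
proof -
  have "computable (\<lambda>x. if P x then of_bool (Q x) else 0)" "computable (\<lambda>x. if P x then 1 else of_bool (Q x))"
    "computable (\<lambda>x. if P x then of_bool (Q x) else 1)"
    using assms by (intro computability; simp add: decidable_def)+
  moreover have "(if a then of_bool b else 0) = (of_bool (a \<and> b) :: nat)"
    "(if a then 1 else of_bool b) = (of_bool (a \<or> b) :: nat)"
    "(if a then of_bool b else 1) = (of_bool (a \<longrightarrow> b) :: nat)" for a b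
    by simp_all
  ultimately show "decidable (\<lambda>x. P x \<and> Q x)" "decidable (\<lambda>x. P x \<or> Q x)" "decidable (\<lambda>x. P x \<longrightarrow> Q x)"
    unfolding decidable_def by (simp_all only:)
qed

lemma decidable_arith [computability]:
  assumes "computable f" "computable g"
  shows "decidable (\<lambda>x. f x \<le> g x)" "decidable (\<lambda>x. f x = g x)"
proof -
  have "computable (\<lambda>x. 1 - (f x - g x))" "computable (\<lambda>x. 1 - ((f x - g x) + (g x - f x)))"
    by (intro computability assms)+
  moreover have "1 - (f x - g x) = of_bool (f x \<le> g x)" "1 - ((f x - g x) + (g x - f x)) = of_bool (f x = g x)" for x
    by auto
  ultimately show "decidable (\<lambda>x. f x \<le> g x)" "decidable (\<lambda>x. f x = g x)"
    unfolding decidable_def by simp_all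
qed

lemma decidable_not [computability]: "decidable P \<Longrightarrow> decidable (\<lambda>x. \<not> P x)"
  using decidable_logic(3)[of P "\<lambda>x. False"] computable_const[of 0] unfolding decidable_def by simp

lemma computable_mult [computability]:
  assumes "computable f" "computable g"
  shows "computable (\<lambda>x. f x * g x)"
proof -
  have "computable (\<lambda>x. rec_nat 0 (\<lambda>n r. r + g x) (f x))"
    by (intro computability assms computable_comp[OF assms(2)])
  moreover have "rec_nat 0 (\<lambda>n r. r + b) a = a * b" for a b :: nat by (induction a) auto
  ultimately show ?thesis by simp
qed

lemma computable_power [computability]:
  assumes "computable f" "computable g"
  shows "computable (\<lambda>x. f x ^ g x)"
proof -
  have "computable (\<lambda>x. rec_nat 1 (\<lambda>n r. r * f x) (g x))"
    by (intro computability assms computable_comp[OF assms(1)])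
  moreover have "rec_nat 1 (\<lambda>n r. r * b) a = b ^ a" for a b :: nat by (induction a) auto
  ultimately show ?thesis by simp
qed

lemma decidable_all_less:
  assumes b: "computable b" and P: "decidable (\<lambda>z. P (pfst z) (psnd z))"
  shows "decidable (\<lambda>x. \<forall>i<b x. P x i)"
proof -
  have "decidable (\<lambda>z. P (pfst z) (pfst (psnd z)))"
    using decidable_comp[OF P, of "\<lambda>z. pair (pfst z) (pfst (psnd z))"] by (simp add: computability)
  then have "computable (\<lambda>x. rec_nat 1 (\<lambda>i r. if P x i then r else 0) (b x))"
    by (intro computability b)
  moreover have "rec_nat 1 (\<lambda>i r. if Q i then r else 0) n = (of_bool (\<forall>i<n. Q i) :: nat)" for n and Q :: "nat \<Rightarrow> bool"
    by (induction n) (auto simp: less_Suc_eq)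
  ultimately show ?thesis unfolding decidable_def by (simp only:)
qed

lemma computable_LEAST:
  assumes P: "decidable (\<lambda>z. P (pfst z) (psnd z))" and ex: "\<And>x. \<exists>y. P x y"
  shows "computable (\<lambda>x. LEAST y. P x y)"
proof -
  have "computable (\<lambda>z. of_bool (\<not> P (pfst z) (psnd z)))"
    using decidable_not[OF P] by (simp add: decidable_def)
  from computable_recfn[OF this, of "Suc 1" "\<lambda>xs. pair (xs ! 1) (xs ! 0)"]
  have "recfn (Suc 1) (\<lambda>xs. of_bool (\<not> P (xs ! 1) (xs ! 0)))"
    by (simp add: recfn_pair recfn_nth)
  then have "recfn 1 (\<lambda>xs. LEAST y. of_bool (\<not> P ((y # xs) ! 1) ((y # xs) ! 0)) = (0::nat))"
    by (rule recfn_LEAST) (use ex in auto)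
  then show ?thesis by (simp add: computable_def)
qed

text \<open>Codes of nonempty lists are successors of pairs.  At the code \<open>0\<close> of the empty list, the truncated
  difference yields \<open>0\<close> for the head and the empty list for the tail, as \<open>pair 0 0 = 0\<close>.\<close>

lemma list_code_hd_tl: 
  "list_decode y = a # as \<Longrightarrow> pfst (y - 1) = a \<and> list_decode (psnd (y - 1)) = as"
  "list_decode y = [] \<Longrightarrow> pfst (y - 1) = 0 \<and> list_decode (psnd (y - 1)) = []"
  by (cases y; simp add: pfst_def psnd_def split: prod.splits; simp add: prod_decode_def prod_decode_aux.simps)+

definition ndrop :: "nat \<Rightarrow> nat \<Rightarrow> nat" where
  "ndrop y i = rec_nat y (\<lambda>_ r. psnd (r - 1)) i"

lemma list_decode_ndrop: "list_decode (ndrop y i) = drop i (list_decode y)"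
proof (induction i)
  case 0
  then show ?case by (simp add: ndrop_def)
next
  case (Suc i)
  have *: "list_decode (psnd (z - 1)) = tl (list_decode z)" for z
    by (cases "list_decode z") (use list_code_hd_tl[of z] in auto)
  show ?case using Suc.IH *[of "ndrop y i"] by (simp add: ndrop_def drop_Suc tl_drop)
qed

lemma computable_ndrop [computability]: "computable f \<Longrightarrow> computable g \<Longrightarrow> computable (\<lambda>x. ndrop (f x) (g x))"
  unfolding ndrop_def by (intro computability)

lemma list_decode_eq_Nil_iff [simp]: "list_decode y = [] \<longleftrightarrow> y = 0"
  by (metis list_decode.simps(1) list_encode.simps(1) list_decode_inverse)

lemma computable_length [computability]:
  assumes "computable f"
  shows "computable (\<lambda>x. length (list_decode (f x)))"
proof -
  have iff: "ndrop y i = 0 \<longleftrightarrow> length (list_decode y) \<le> i" for y i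
    using list_decode_ndrop[of y i] by (metis drop_eq_Nil list_decode_eq_Nil_iff)
  have "computable (\<lambda>y. LEAST i. ndrop y i = 0)"
  proof (rule computable_LEAST)
    show "decidable (\<lambda>z. ndrop (pfst z) (psnd z) = 0)" by (intro computability)
  qed (use iff in blast)
  moreover have "(LEAST i. ndrop y i = 0) = length (list_decode y)" for y
    by (rule Least_equality) (auto simp: iff)
  ultimately have "computable (\<lambda>y. length (list_decode y))" by simp
  from computable_comp[OF this assms] show ?thesis .
qed

definition nnth :: "nat \<Rightarrow> nat \<Rightarrow> nat" where
  "nnth y i = pfst (ndrop y i - 1)"

lemma nnth: "i < length (list_decode y) \<Longrightarrow> nnth y i = list_decode y ! i"
  using list_decode_ndrop[of y i] list_code_hd_tl(1)[of "ndrop y i"]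
  by (simp add: nnth_def Cons_nth_drop_Suc[symmetric])

lemma computable_nnth [computability]: "computable f \<Longrightarrow> computable g \<Longrightarrow> computable (\<lambda>x. nnth (f x) (g x))"
  unfolding nnth_def by (intro computability)

lemma decidable_ball [computability]:
  assumes f: "computable f" and P: "decidable (\<lambda>z. P (pfst z) (psnd z))"
  shows "decidable (\<lambda>x. \<forall>e\<in>set (list_decode (f x)). P x e)"
proof -
  have "decidable (\<lambda>x. \<forall>i<length (list_decode (f x)). P x (nnth (f x) i))"
  proof (rule decidable_all_less)
    show "decidable (\<lambda>z. P (pfst z) (nnth (f (pfst z)) (psnd z)))"
      using decidable_comp[OF P, of "\<lambda>z. pair (pfst z) (nnth (f (pfst z)) (psnd z))"] computable_comp[OF f]
      by (simp add: computability)
  qed (intro computability f)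
  moreover have "(\<forall>i<length (list_decode y). Q (nnth y i)) \<longleftrightarrow> (\<forall>e\<in>set (list_decode y). Q e)" for y Q
    by (auto simp: all_set_conv_all_nth nnth)
  ultimately show ?thesis by simp
qed

lemma decidable_bex [computability]:
  assumes f: "computable f" and P: "decidable (\<lambda>z. P (pfst z) (psnd z))"
  shows "decidable (\<lambda>x. \<exists>e\<in>set (list_decode (f x)). P x e)"
  using decidable_not[OF decidable_ball[OF f decidable_not[OF P]]] by simp

lemma rec_nat_foldl:
  "rec_nat s (\<lambda>i r. h r (xs ! i)) (length xs) = foldl h s xs"
proof (induction xs rule: rev_induct)
  case (snoc x xs)
  have "rec_nat s (\<lambda>i r. h r ((xs @ [x]) ! i)) n = rec_nat s (\<lambda>i r. h r (xs ! i)) n" if "n \<le> length xs" for n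
    using that by (induction n) (auto simp: nth_append)
  with snoc show ?case by simp
qed simp

lemma computable_foldl:
  assumes s: "computable s" and f: "computable f" and h: "computable (\<lambda>z. h (pfst z) (psnd z))"
  shows "computable (\<lambda>x. foldl h (s x) (list_decode (f x)))"
proof -
  have "computable (\<lambda>x. rec_nat (s x) (\<lambda>i r. h r (nnth (f x) i)) (length (list_decode (f x))))"
  proof (intro computable_rec_nat)
    show "computable (\<lambda>z. h (psnd (psnd z)) (nnth (f (pfst z)) (pfst (psnd z))))"
      using computable_comp[OF h, of "\<lambda>z. pair (psnd (psnd z)) (nnth (f (pfst z)) (pfst (psnd z)))"] computable_comp[OF f]
      by (simp add: computability)
  qed (intro computability s f)+
  moreover have "rec_nat a (\<lambda>i r. h r (nnth y i)) (length (list_decode y)) = foldl h a (list_decode y)" for a y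
  proof -
    have "rec_nat a (\<lambda>i r. h r (nnth y i)) n = rec_nat a (\<lambda>i r. h r (list_decode y ! i)) n"
      if "n \<le> length (list_decode y)" for n
      using that by (induction n) (auto simp: nnth)
    then show ?thesis by (simp add: rec_nat_foldl)
  qed
  ultimately show ?thesis by simp
qed

text \<open>Finite control needs no program: a function on a finite set is computed by a finite table.\<close>

lemma finite_table:
  assumes "finite D" "inj_on \<kappa> D"
  shows "\<exists>t. computable t \<and> (\<forall>d\<in>D. t (\<kappa> d) = F d)"
  using assms
proof (induction D)
  case empty
  show ?case using computable_id by blast
next
  case (insert d D)
  then obtain t where t: "computable t" "\<forall>d\<in>D. t (\<kappa> d) = F d" by auto
  have "computable (\<lambda>x. if x = \<kappa> d then F d else t x)"
    by (intro computability t)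
  moreover have "\<forall>e\<in>insert d D. (if \<kappa> e = \<kappa> d then F d else t (\<kappa> e)) = F e"
    using insert t by (auto simp: inj_on_def)
  ultimately show ?case by blast
qed

lemma decidable_mem_finite: "finite D \<Longrightarrow> decidable (\<lambda>x. x \<in> D)"
proof (induction D rule: finite_induct)
  case empty
  then show ?case unfolding decidable_def by (simp add: computable_const)
next
  case (insert d D)
  have "decidable (\<lambda>x. x = d \<or> x \<in> D)" by (intro computability insert)
  then show ?case by simp
qed

section \<open>Computing intersections\<close>

lemma length_list_decode_le: "length (list_decode n) \<le> n"
proof -
  have "length xs \<le> list_encode xs" for xs
    by (induction xs) (auto intro: order_trans le_prod_encode_2)
  from this[of "list_decode n"] show ?thesis by simp
qed

lemma mem_list_decode_le: "x \<in> set (list_decode n) \<Longrightarrow> x \<le> n"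
proof -
  have "x \<in> set xs \<Longrightarrow> x \<le> list_encode xs" for xs
  proof (induction xs)
    case (Cons y ys)
    then show ?case
      using le_prod_encode_1[of y "list_encode ys"] le_prod_encode_2[of "list_encode ys" y] by auto
  qed simp
  from this[of "list_decode n"] show "x \<in> set (list_decode n) \<Longrightarrow> x \<le> n" by simp
qed

lemma ex_list_code: "finite S \<Longrightarrow> \<exists>n. set (list_decode n) = S"
  by (metis finite_list list_encode_inverse)

text \<open>Elements are written as words in the letters \<open>\<Lambda>\<close>, where the letter \<open>l\<close> has the value \<open>val l\<close>.  The
  number \<open>\<nu> g\<close> is a canonical name of \<open>g\<close>, and \<open>step\<close> updates it when \<open>g\<close> is multiplied by a letter.
  So comparing the names reached after reading two words solves the word problem.  All numbers count
  as letters, words or lists of words, which makes all searches below succeed on every input.\<close>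

locale computable_tree_length = tree_length +
  fixes val :: "nat \<Rightarrow> 'a" and \<Lambda> :: "nat set" and \<nu> :: "'a \<Rightarrow> nat"
    and step :: "nat \<Rightarrow> nat \<Rightarrow> nat" and hgt :: "nat \<Rightarrow> nat" and B :: "nat \<Rightarrow> nat"
  assumes finite_letters: "finite \<Lambda>"
    and val_closed: "\<And>l. val l \<in> carrier G" and len_val: "\<And>l. len (val l) \<le> 1"
    and word_ex: "\<And>g. g \<in> carrier G \<Longrightarrow> \<exists>w\<in>lists \<Lambda>. g = lprod (map val w)"
    and inj_\<nu>: "inj_on \<nu> (carrier G)"
    and \<nu>_step: "\<And>g l. g \<in> carrier G \<Longrightarrow> \<nu> (g \<otimes> val l) = step (\<nu> g) l"
    and computable_step: "computable (\<lambda>z. step (pfst z) (psnd z))"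
    and computable_hgt: "computable hgt" and hgt: "\<And>g. g \<in> carrier G \<Longrightarrow> hgt (\<nu> g) = len g"
    and computable_B: "computable B" and card_ball: "\<And>m. card (ball m) \<le> B m"
begin

definition ev :: "nat \<Rightarrow> 'a" where
  "ev w = lprod (map val (list_decode w))"

definition evs :: "nat \<Rightarrow> 'a" where
  "evs t = lprod (map ev (list_decode t))"

text \<open>Words and lists of words as transformations of names.\<close>

definition read :: "nat \<Rightarrow> nat \<Rightarrow> nat" where
  "read s w = foldl step s (list_decode w)"

definition reads :: "nat \<Rightarrow> nat \<Rightarrow> nat" where
  "reads s t = foldl read s (list_decode t)"

lemma map_val_closed: "set (map val w) \<subseteq> carrier G"
  using val_closed by auto

lemma ev_closed [simp, intro]: "ev w \<in> carrier G"
  unfolding ev_def by (intro lprod_closed map_val_closed)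

lemma map_ev_closed: "set (map ev w) \<subseteq> carrier G"
  by auto

lemma evs_closed [simp, intro]: "evs t \<in> carrier G"
  unfolding evs_def by (intro lprod_closed map_ev_closed)

lemma read: "g \<in> carrier G \<Longrightarrow> read (\<nu> g) w = \<nu> (g \<otimes> ev w)"
proof -
  have "g \<in> carrier G \<Longrightarrow> foldl step (\<nu> g) ls = \<nu> (g \<otimes> lprod (map val ls))" for ls
    by (induction ls arbitrary: g)
      (simp_all add: \<nu>_step[symmetric] val_closed m_assoc lprod_closed[OF map_val_closed])
  then show "g \<in> carrier G \<Longrightarrow> ?thesis" by (simp add: read_def ev_def)
qed

lemma reads: "g \<in> carrier G \<Longrightarrow> reads (\<nu> g) t = \<nu> (g \<otimes> evs t)"
proof -
  have "g \<in> carrier G \<Longrightarrow> foldl read (\<nu> g) ls = \<nu> (g \<otimes> lprod (map ev ls))" for ls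
    by (induction ls arbitrary: g)
      (simp_all add: read m_assoc lprod_closed[OF map_ev_closed])
  then show "g \<in> carrier G \<Longrightarrow> ?thesis" by (simp add: reads_def evs_def)
qed

lemma \<nu>_eq_iff: "g \<in> carrier G \<Longrightarrow> h \<in> carrier G \<Longrightarrow> \<nu> g = \<nu> h \<longleftrightarrow> g = h"
  using inj_\<nu> by (auto dest: inj_onD)

definition gens :: "nat \<Rightarrow> 'a set" where
  "gens h = ev ` set (list_decode h)"

abbreviation subgrp :: "nat \<Rightarrow> 'a set" where
  "subgrp h \<equiv> generate G (gens h)"

lemma gens_closed: "gens h \<subseteq> carrier G"
  by (auto simp: gens_def)

text \<open>The code of a list bounds its length and its entries, so it serves as a crude bound for lengths.\<close>

lemma gens_ball: "gens h \<subseteq> ball h"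
proof
  fix g assume "g \<in> gens h"
  then obtain w where w: "w \<in> set (list_decode h)" "g = ev w" by (auto simp: gens_def)
  have "len (lprod (map val ls)) \<le> length ls" for ls
  proof (induction ls)
    case (Cons l ls)
    have "len (val l \<otimes> lprod (map val ls)) \<le> len (val l) + len (lprod (map val ls))"
      by (intro len_mult val_closed lprod_closed map_val_closed)
    then show ?case using Cons len_val[of l] by simp
  qed (simp add: len_one)
  then have "len (ev w) \<le> length (list_decode w)" by (simp add: ev_def)
  also have "\<dots> \<le> w" by (rule length_list_decode_le)
  also have "\<dots> \<le> h" using w by (intro mem_list_decode_le)
  finally show "g \<in> ball h" using w by simp
qed

text \<open>The entries of \<open>t\<close> are words for the generators coded by \<open>h\<close>, or for their inverses.  Such a list of
  words is evidence that its product belongs to the subgroup.\<close>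

definition gen_product :: "nat \<Rightarrow> nat \<Rightarrow> bool" where
  "gen_product h t \<longleftrightarrow> (\<forall>u\<in>set (list_decode t). \<exists>v\<in>set (list_decode h).
    u = v \<or> read (read (\<nu> \<one>) u) v = \<nu> \<one>)"

text \<open>In terms of names, and hence decidable: the products of the entries of \<open>T\<close> lie in the subgroup
  generated by \<open>h\<close> and form a set to which saturation applies; see \<open>saturated_iff\<close>.\<close>

definition saturated :: "nat \<Rightarrow> nat \<Rightarrow> nat \<Rightarrow> bool" where
  "saturated h L T \<longleftrightarrow>
    (\<forall>t\<in>set (list_decode T). gen_product h t) \<and>
    (\<exists>t\<in>set (list_decode T). reads (\<nu> \<one>) t = \<nu> \<one>) \<and>
    (\<forall>u\<in>set (list_decode h).
      (\<exists>t\<in>set (list_decode T). reads (\<nu> \<one>) t = read (\<nu> \<one>) u) \<and>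
      (\<exists>t\<in>set (list_decode T). read (reads (\<nu> \<one>) t) u = \<nu> \<one>)) \<and>
    (\<forall>s\<in>set (list_decode T). \<forall>t\<in>set (list_decode T).
      hgt (reads (reads (\<nu> \<one>) s) t) \<le> L \<longrightarrow>
      (\<exists>r\<in>set (list_decode T). reads (\<nu> \<one>) r = reads (reads (\<nu> \<one>) s) t))"

lemma read_inverse_iff: "read (read (\<nu> \<one>) u) v = \<nu> \<one> \<longleftrightarrow> ev u = inv (ev v)"
proof -
  have "ev u \<otimes> ev v = \<one> \<longleftrightarrow> ev u = inv (ev v)"
    by (metis ev_closed inv_equality l_inv inv_inv)
  then show ?thesis by (simp add: read \<nu>_eq_iff)
qed

lemma reads_inverse_iff: "read (reads (\<nu> \<one>) t) v = \<nu> \<one> \<longleftrightarrow> evs t = inv (ev v)"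
proof -
  have "evs t \<otimes> ev v = \<one> \<longleftrightarrow> evs t = inv (ev v)"
    by (metis ev_closed evs_closed inv_equality l_inv inv_inv)
  then show ?thesis by (simp add: read reads \<nu>_eq_iff)
qed

lemma gen_product_iff:
  "gen_product h t \<longleftrightarrow> (\<forall>u\<in>set (list_decode t). \<exists>v\<in>set (list_decode h). u = v \<or> ev u = inv (ev v))"
  by (simp add: gen_product_def read_inverse_iff)

lemma saturated_iff:
  "saturated h L T \<longleftrightarrow>
    (\<forall>t\<in>set (list_decode T). gen_product h t) \<and> \<one> \<in> evs ` set (list_decode T) \<and>
    gens h \<subseteq> evs ` set (list_decode T) \<and> m_inv G ` gens h \<subseteq> evs ` set (list_decode T) \<and>
    (\<forall>s\<in>evs ` set (list_decode T). \<forall>t\<in>evs ` set (list_decode T).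
      len (s \<otimes> t) \<le> L \<longrightarrow> s \<otimes> t \<in> evs ` set (list_decode T))"
proof -
  have 1: "(\<exists>t\<in>set (list_decode T). reads (\<nu> \<one>) t = \<nu> g) \<longleftrightarrow> g \<in> evs ` set (list_decode T)"
    if "g \<in> carrier G" for g using that by (auto simp: reads \<nu>_eq_iff)
  have 2: "reads (reads (\<nu> \<one>) s) t = \<nu> (evs s \<otimes> evs t)" for s t by (simp add: reads)
  have 3: "(\<exists>t\<in>set (list_decode T). read (reads (\<nu> \<one>) t) u = \<nu> \<one>) \<longleftrightarrow> inv (ev u) \<in> evs ` set (list_decode T)" for u
    unfolding reads_inverse_iff by (metis image_iff)
  have 4: "read (\<nu> \<one>) u = \<nu> (ev u)" for u by (simp add: read)
  have 5: "(\<forall>u\<in>set (list_decode h). ev u \<in> evs ` set (list_decode T) \<and> inv (ev u) \<in> evs ` set (list_decode T)) \<longleftrightarrow>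
      gens h \<subseteq> evs ` set (list_decode T) \<and> m_inv G ` gens h \<subseteq> evs ` set (list_decode T)"
    unfolding gens_def image_subset_iff by blast
  have 6: "(\<forall>s\<in>set (list_decode T). \<forall>t\<in>set (list_decode T).
        len (evs s \<otimes> evs t) \<le> L \<longrightarrow> evs s \<otimes> evs t \<in> evs ` set (list_decode T)) \<longleftrightarrow>
      (\<forall>s\<in>evs ` set (list_decode T). \<forall>t\<in>evs ` set (list_decode T).
        len (s \<otimes> t) \<le> L \<longrightarrow> s \<otimes> t \<in> evs ` set (list_decode T))"
    by simp
  show ?thesis
    unfolding saturated_def 2 3 4 1[OF one_closed] 1[OF ev_closed] 1[OF m_closed[OF evs_closed evs_closed]]
      hgt[OF m_closed[OF evs_closed evs_closed]] 5 6 conj_assoc ..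
qed

lemma evs_gen_product: "gen_product h t \<Longrightarrow> evs t \<in> subgrp h"
  unfolding evs_def gen_product_iff
  by (rule lprod_in_subgroup[OF generate_is_subgroup[OF gens_closed]])
    (fastforce simp: gens_def intro: generate.incl generate.inv)

lemma gen_product_ex:
  assumes "g \<in> subgrp h"
  shows "\<exists>t. gen_product h t \<and> evs t = g"
proof -
  obtain ys where ys: "set ys \<subseteq> gens h \<union> m_inv G ` gens h" "g = lprod ys"
    using assms unfolding generate_eq_lprod[OF gens_closed] by auto
  have "\<exists>u. ev u = y \<and> (\<exists>v\<in>set (list_decode h). u = v \<or> ev u = inv (ev v))"
    if y: "y \<in> gens h \<union> m_inv G ` gens h" for y
  proof -
    have "y \<in> carrier G" using y gens_closed by auto
    then obtain w where "y = lprod (map val w)" using word_ex by blast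
    then have "ev (list_encode w) = y" by (simp add: ev_def)
    then show ?thesis using y by (auto simp: gens_def)
  qed
  then have "\<forall>y\<in>gens h \<union> m_inv G ` gens h. \<exists>u. ev u = y \<and> (\<exists>v\<in>set (list_decode h). u = v \<or> ev u = inv (ev v))"
    by blast
  from bchoice[OF this] obtain f where f: "\<And>y. y \<in> gens h \<union> m_inv G ` gens h \<Longrightarrow>
      ev (f y) = y \<and> (\<exists>v\<in>set (list_decode h). f y = v \<or> ev (f y) = inv (ev v))"
    by blast
  have "map ev (map f ys) = ys" using f ys(1) by (simp add: map_idI subset_iff)
  moreover have "\<exists>v\<in>set (list_decode h). f y = v \<or> ev (f y) = inv (ev v)" if "y \<in> set ys" for y
    using f ys(1) that by blast
  ultimately show ?thesis using ys(2)
    by (intro exI[of _ "list_encode (map f ys)"]) (auto simp: gen_product_iff evs_def)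
qed

text \<open>All elements of the subgroup up to a given length form a saturated set.  The length is chosen so
  large that the generators are included; this makes the search for \<open>T\<close> total.\<close>

lemma saturated_ex: "\<exists>T. saturated h L T"
proof -
  let ?M = "max h L"
  let ?F = "subgrp h \<inter> ball ?M"
  have "\<forall>g\<in>subgrp h. \<exists>t. gen_product h t \<and> evs t = g" using gen_product_ex by blast
  from bchoice[OF this] obtain f where f: "\<And>g. g \<in> subgrp h \<Longrightarrow> gen_product h (f g) \<and> evs (f g) = g"
    by blast
  have "finite (f ` ?F)" using finite_ball[of ?M] by (intro finite_imageI finite_Int) auto
  then obtain T where T: "set (list_decode T) = f ` ?F" using ex_list_code by blast
  have eT: "evs ` set (list_decode T) = ?F" unfolding T image_image using f by (auto simp: image_iff)
  note sg = generate_is_subgroup[OF gens_closed, of h]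
  have 1: "gens h \<subseteq> ball ?M" using gens_ball[of h] by auto
  have 2: "m_inv G ` gens h \<subseteq> ball ?M" using ball_Un_inv[OF 1] by simp
  have "gens h \<subseteq> subgrp h" "m_inv G ` gens h \<subseteq> subgrp h" by (auto intro: generate.incl generate.inv)
  then have "saturated h L T"
    unfolding saturated_iff eT
  proof (intro conjI ballI impI)
    show "\<one> \<in> ?F" using subgroup.one_closed[OF sg] len_one by simp
    show "gen_product h t" if "t \<in> set (list_decode T)" for t using that T f by auto
    show "gens h \<subseteq> ?F" "m_inv G ` gens h \<subseteq> ?F" using 1 2 \<open>gens h \<subseteq> subgrp h\<close> \<open>m_inv G ` gens h \<subseteq> subgrp h\<close> by blast+
    show "s \<otimes> t \<in> ?F" if "s \<in> ?F" "t \<in> ?F" "len (s \<otimes> t) \<le> L" for s t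
      using that subgroup.m_closed[OF sg, of s t] by simp
  qed
  then show ?thesis ..
qed

lemma saturated:
  assumes "saturated h L T" "h \<le> m" "3 * m + 1 \<le> L"
  shows "subgrp h \<inter> ball L \<subseteq> evs ` set (list_decode T)" "evs ` set (list_decode T) \<subseteq> subgrp h"
proof -
  have "gens h \<subseteq> ball m" using gens_ball[of h] assms(2) by auto
  then show "subgrp h \<inter> ball L \<subseteq> evs ` set (list_decode T)"
    by (rule saturated_contains_ball) (use assms in \<open>auto simp: saturated_iff\<close>)
  show "evs ` set (list_decode T) \<subseteq> subgrp h"
    using assms(1) evs_gen_product by (auto simp: saturated_iff)
qed

text \<open>The words in \<open>C\<close> spell exactly the elements that occur in both \<open>S\<close> and \<open>T\<close>.  They are required to
  use proper letters, because they make up the output.\<close>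

definition common :: "nat \<Rightarrow> nat \<Rightarrow> nat \<Rightarrow> bool" where
  "common S T C \<longleftrightarrow>
    (\<forall>w\<in>set (list_decode C). (\<forall>l\<in>set (list_decode w). l \<in> \<Lambda>) \<and>
      (\<exists>s\<in>set (list_decode S). reads (\<nu> \<one>) s = read (\<nu> \<one>) w) \<and>
      (\<exists>t\<in>set (list_decode T). reads (\<nu> \<one>) t = read (\<nu> \<one>) w)) \<and>
    (\<forall>s\<in>set (list_decode S). \<forall>t\<in>set (list_decode T). reads (\<nu> \<one>) s = reads (\<nu> \<one>) t \<longrightarrow>
      (\<exists>w\<in>set (list_decode C). read (\<nu> \<one>) w = reads (\<nu> \<one>) s))"

lemma common_iff:
  "common S T C \<longleftrightarrow> (\<forall>w\<in>set (list_decode C). set (list_decode w) \<subseteq> \<Lambda>) \<and>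
    gens C = evs ` set (list_decode S) \<inter> evs ` set (list_decode T)"
proof -
  have 1: "(\<exists>t\<in>set (list_decode T). \<nu> (evs t) = \<nu> g) \<longleftrightarrow> g \<in> evs ` set (list_decode T)"
    if "g \<in> carrier G" for g T using that by (auto simp: \<nu>_eq_iff)
  have 2: "(\<exists>w\<in>set (list_decode C). \<nu> (ev w) = \<nu> g) \<longleftrightarrow> g \<in> gens C"
    if "g \<in> carrier G" for g using that by (auto simp: \<nu>_eq_iff gens_def)
  have 3: "reads (\<nu> \<one>) t = \<nu> (evs t)" "read (\<nu> \<one>) u = \<nu> (ev u)" for t u by (simp_all add: read reads)
  have 4: "\<nu> (evs s) = \<nu> (evs t) \<longleftrightarrow> evs s = evs t" for s t by (simp add: \<nu>_eq_iff)
  have 5: "(\<forall>s\<in>set (list_decode S). \<forall>t\<in>set (list_decode T). evs s = evs t \<longrightarrow> evs s \<in> gens C) \<longleftrightarrow>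
      evs ` set (list_decode S) \<inter> evs ` set (list_decode T) \<subseteq> gens C"
    by (auto simp: subset_iff image_iff)
  show ?thesis
    by (simp only: common_def 3 4 1[OF ev_closed] 2[OF evs_closed] 5) (auto simp: gens_def)
qed

lemma common_ex: "\<exists>C. common S T C"
proof -
  let ?F = "evs ` set (list_decode S) \<inter> evs ` set (list_decode T)"
  have "\<exists>w. set (list_decode w) \<subseteq> \<Lambda> \<and> ev w = g" if "g \<in> ?F" for g
  proof -
    have "g \<in> carrier G" using that by auto
    then obtain w where "w \<in> lists \<Lambda>" "g = lprod (map val w)" using word_ex by blast
    then show ?thesis by (intro exI[of _ "list_encode w"]) (auto simp: ev_def)
  qed
  then have "\<forall>g\<in>?F. \<exists>w. set (list_decode w) \<subseteq> \<Lambda> \<and> ev w = g" by blast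
  from bchoice[OF this] obtain f where f: "\<And>g. g \<in> ?F \<Longrightarrow> set (list_decode (f g)) \<subseteq> \<Lambda> \<and> ev (f g) = g"
    by blast
  obtain C where C: "set (list_decode C) = f ` ?F" using ex_list_code[of "f ` ?F"] by auto
  have "gens C = ?F" unfolding gens_def C image_image using f by (auto simp: image_iff)
  then have "common S T C" unfolding common_iff using C f by auto
  then show ?thesis ..
qed

lemma computable_read [computability]: "computable f \<Longrightarrow> computable g \<Longrightarrow> computable (\<lambda>x. read (f x) (g x))"
  unfolding read_def by (rule computable_foldl[OF _ _ computable_step])

lemma computable_reads [computability]: "computable f \<Longrightarrow> computable g \<Longrightarrow> computable (\<lambda>x. reads (f x) (g x))"
  unfolding reads_def by (rule computable_foldl) (assumption | intro computability)+

lemma decidable_saturated: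
  "decidable (\<lambda>z. saturated (pfst (pfst z)) (psnd (pfst z)) (psnd z))"
  unfolding saturated_def gen_product_def
  by (intro computability computable_comp[OF computable_hgt])

lemma decidable_common:
  "decidable (\<lambda>z. common (pfst (pfst z)) (psnd (pfst z)) (psnd z))"
  unfolding common_def by (intro computability decidable_comp[OF decidable_mem_finite[OF finite_letters]])

text \<open>The composition of three searches: for saturated sets of the two subgroups and for words that spell
  their common elements.\<close>

theorem intersection_computable:
  "\<exists>F. computable F \<and> (\<forall>h k.
    (\<forall>w\<in>set (list_decode (F (pair h k))). set (list_decode w) \<subseteq> \<Lambda>) \<and>
    subgrp (F (pair h k)) = subgrp h \<inter> subgrp k)"
proof -
  \<comment> \<open>large enough for both \<open>saturated_contains_ball\<close> and \<open>inter_generated\<close>, with \<open>m = h + k\<close>\<close>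
  define L where "L z = 2 * B (pfst z + psnd z) ^ 2 + 3 * (pfst z + psnd z) + 1" for z
  define sat where "sat x = (LEAST T. saturated (pfst x) (psnd x) T)" for x
  define out where "out x = (LEAST C. common (pfst x) (psnd x) C)" for x
  define F where "F z = out (pair (sat (pair (pfst z) (L z))) (sat (pair (psnd z) (L z))))" for z
  have L: "computable L" unfolding L_def by (intro computability computable_comp[OF computable_B])
  have sat: "computable sat" unfolding sat_def
    by (rule computable_LEAST[OF decidable_saturated saturated_ex])
  have out: "computable out" unfolding out_def
    by (rule computable_LEAST[OF decidable_common common_ex])
  have "computable F"
    unfolding F_def by (intro computability computable_comp[OF out] computable_comp[OF sat] computable_comp[OF L])
  moreover have "(\<forall>w\<in>set (list_decode (F (pair h k))). set (list_decode w) \<subseteq> \<Lambda>) \<and>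
      subgrp (F (pair h k)) = subgrp h \<inter> subgrp k" for h k
  proof -
    let ?L = "L (pair h k)" and ?m = "h + k"
    let ?S = "sat (pair h ?L)" and ?T = "sat (pair k ?L)"
    have "saturated h ?L ?S" "saturated k ?L ?T"
      unfolding sat_def pfst_psnd_pair by (rule LeastI_ex[OF saturated_ex])+
    moreover have "card (ball ?m) ^ 2 \<le> B ?m ^ 2" by (rule power_mono[OF card_ball]) simp
    then have m: "3 * ?m + 1 \<le> ?L" "2 * card (ball ?m) ^ 2 \<le> ?L"
      unfolding L_def pfst_psnd_pair by linarith+
    ultimately have S: "subgrp h \<inter> ball ?L \<subseteq> evs ` set (list_decode ?S)" "evs ` set (list_decode ?S) \<subseteq> subgrp h"
      and T: "subgrp k \<inter> ball ?L \<subseteq> evs ` set (list_decode ?T)" "evs ` set (list_decode ?T) \<subseteq> subgrp k"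
      using saturated[of h ?L ?S ?m] saturated[of k ?L ?T ?m] by auto
    have "common ?S ?T (F (pair h k))"
      unfolding F_def out_def pfst_psnd_pair by (rule LeastI_ex[OF common_ex])
    then have F: "\<forall>w\<in>set (list_decode (F (pair h k))). set (list_decode w) \<subseteq> \<Lambda>"
      "gens (F (pair h k)) = evs ` set (list_decode ?S) \<inter> evs ` set (list_decode ?T)"
      unfolding common_iff by auto
    have sub: "subgroup (subgrp h \<inter> subgrp k) G"
      by (intro subgroups_Inter_pair generate_is_subgroup gens_closed)
    have "gens h \<subseteq> ball ?m" "gens k \<subseteq> ball ?m" using gens_ball[of h] gens_ball[of k] by auto
    from inter_generated[OF this m(2)]
    have "subgrp h \<inter> subgrp k \<subseteq> generate G (subgrp h \<inter> subgrp k \<inter> ball ?L)" by simp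
    also have "\<dots> \<subseteq> subgrp (F (pair h k))"
      by (rule mono_generate) (use S T F in auto)
    finally have "subgrp h \<inter> subgrp k \<subseteq> subgrp (F (pair h k))" .
    moreover have "subgrp (F (pair h k)) \<subseteq> subgrp h \<inter> subgrp k"
      by (rule generate_subgroup_incl[OF _ sub]) (use S T F in auto)
    ultimately show ?thesis using F by auto
  qed
  ultimately show ?thesis by blast
qed

end

section \<open>Normal forms as numbers\<close>

lemma foldl_list_code_Cons: "foldl (\<lambda>r x. Suc (pair x r)) (list_encode ys) xs = list_encode (rev xs @ ys)"
  by (induction xs arbitrary: ys) (simp_all flip: list_encode.simps)

context amalgam
begin

lemma act_Cons:
  "act i x (p # stk, a) = (fst (act i x ([p], a)) @ stk, snd (act i x ([p], a)))"
  by (cases p) (simp add: act_def pack_def)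

end

context amalgamated_product
begin

text \<open>A state is coded as the list consisting of its element of \<open>A\<close> and its stack.  The action of a letter
  depends only on this element and on the top syllable, and it replaces them by finitely many
  entries.  So a finite table together with the list operations computes it.\<close>

lemma state_coding:
  assumes fin: "finite \<Lambda>" and val: "\<And>l. l \<in> \<Lambda> \<Longrightarrow> \<exists>i x. x \<in> carrier (Gr i) \<and> val l = \<iota> i x"
    and val_one: "\<And>l. l \<notin> \<Lambda> \<Longrightarrow> val l = \<one>"
  obtains \<nu> step hgt where "inj_on \<nu> (carrier G)"
    "\<And>g l. g \<in> carrier G \<Longrightarrow> \<nu> (g \<otimes> val l) = step (\<nu> g) l"
    "computable (\<lambda>z. step (pfst z) (psnd z))"
    "computable hgt" "\<And>g. g \<in> carrier G \<Longrightarrow> hgt (\<nu> g) = len g"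
proof -
  have "\<forall>l\<in>\<Lambda>. \<exists>ix. snd ix \<in> carrier (Gr (fst ix)) \<and> val l = \<iota> (fst ix) (snd ix)" using val by force
  from bchoice[OF this] obtain ix where
    ix: "\<forall>l\<in>\<Lambda>. snd (ix l) \<in> carrier (Gr (fst (ix l))) \<and> val l = \<iota> (fst (ix l)) (snd (ix l))"
    by blast
  define idx elt where "idx l = fst (ix l)" and "elt l = snd (ix l)" for l
  have lt: "elt l \<in> carrier (Gr (idx l)) \<and> val l = \<iota> (idx l) (elt l)" if "l \<in> \<Lambda>" for l
    using ix that by (simp add: idx_def elt_def)
  obtain \<sigma>0 :: "'i \<times> 'g \<Rightarrow> nat" where \<sigma>0: "inj_on \<sigma>0 symbols"
    using finite_imp_inj_to_nat_seg[OF finite_symbols] by blast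
  obtain \<alpha> :: "'a \<Rightarrow> nat" where \<alpha>: "inj_on \<alpha> (carrier A)"
    using finite_imp_inj_to_nat_seg[OF finite_base] by blast
  define \<sigma> where "\<sigma> p = Suc (\<sigma>0 p)" for p
  have \<sigma>: "inj_on \<sigma> symbols" using \<sigma>0 by (auto simp: \<sigma>_def inj_on_def)
  define code where "code = (\<lambda>(stk, a). list_encode (\<alpha> a # map \<sigma> stk))"
  have "inj_on code states"
  proof (rule inj_onI)
    fix st st' assume st: "st \<in> states" "st' \<in> states" "code st = code st'"
    have "inj_on \<sigma> (set (fst st) \<union> set (fst st'))"
      by (rule inj_on_subset[OF \<sigma>]) (use st in \<open>auto simp: states_def\<close>)
    then show "st = st'"
      using st inj_onD[OF \<alpha>] map_inj_on[of \<sigma> "fst st" "fst st'"]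
      by (auto simp: states_def code_def list_encode_eq)
  qed
  then have inj: "inj_on (code \<circ> nf) (carrier G)"
    using inj_nf nf_in by (intro comp_inj_on) (auto intro: inj_on_subset)
  \<comment> \<open>the part of the stack that the action can see; an empty stack is coded by \<open>0\<close>, which \<open>\<sigma>\<close> avoids\<close>
  define tops where "tops = {[]} \<union> (\<lambda>p. [p]) ` symbols"
  define \<tau> where "\<tau> = (\<lambda>t. if t = [] then 0 else \<sigma> (hd t))"
  define \<kappa> where "\<kappa> = (\<lambda>(l, a, t). pair l (pair (\<alpha> a) (\<tau> t)))"
  have "inj_on \<kappa> (\<Lambda> \<times> carrier A \<times> tops)"
    using \<alpha> \<sigma> by (auto simp: inj_on_def \<kappa>_def tops_def \<tau>_def \<sigma>_def)
  moreover have "finite (\<Lambda> \<times> carrier A \<times> tops)"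
    using fin finite_base finite_symbols by (simp add: tops_def)
  ultimately obtain tab where tab: "computable tab" "\<And>l a t. l \<in> \<Lambda> \<Longrightarrow> a \<in> carrier A \<Longrightarrow> t \<in> tops \<Longrightarrow>
      tab (\<kappa> (l, a, t)) = (case act (idx l) (elt l) (t, a) of (stk, b) \<Rightarrow> list_encode (rev (\<alpha> b # map \<sigma> stk)))"
    using finite_table[of "\<Lambda> \<times> carrier A \<times> tops" \<kappa>
      "\<lambda>(l, a, t). case act (idx l) (elt l) (t, a) of (stk, b) \<Rightarrow> list_encode (rev (\<alpha> b # map \<sigma> stk))"]
    by fastforce
  \<comment> \<open>the table gives the new entries in reverse order, to be pushed onto the tail of the tail of \<open>y\<close>\<close>
  define step where "step y l = (if l \<in> \<Lambda> then
      foldl (\<lambda>r x. Suc (pair x r)) (psnd (psnd (y - 1) - 1))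
        (list_decode (tab (pair l (pair (pfst (y - 1)) (pfst (psnd (y - 1) - 1))))))
    else y)" for y l
  have 1: "computable (\<lambda>z. step (pfst z) (psnd z))"
    unfolding step_def
    by (intro computability computable_foldl computable_comp[OF tab(1)] decidable_comp[OF decidable_mem_finite[OF fin]])
  have 2: "(code \<circ> nf) (g \<otimes> val l) = step ((code \<circ> nf) g) l" if g: "g \<in> carrier G" for g l
  proof (cases "l \<in> \<Lambda>")
    case False
    then show ?thesis using g by (simp add: step_def val_one)
  next
    case True
    obtain stk a where n: "nf g = (stk, a)" by fastforce
    have st: "set stk \<subseteq> symbols" "a \<in> carrier A" using nf_in[OF g] n by (auto simp: states_def)
    define t where "t = take 1 stk"
    have t: "t \<in> tops" using st by (cases stk) (auto simp: t_def tops_def)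
    obtain stk' b where act: "act (idx l) (elt l) (t, a) = (stk', b)" by fastforce
    have "nf (g \<otimes> val l) = act (idx l) (elt l) (stk, a)"
      using nf_mult[OF g] lt[OF True] n by metis
    also have "\<dots> = (stk' @ drop 1 stk, b)"
      using act act_Cons[of "idx l" "elt l" "hd stk" "tl stk" a] by (cases stk) (auto simp: t_def)
    finally have "code (nf (g \<otimes> val l)) = list_encode (rev (rev (\<alpha> b # map \<sigma> stk')) @ map \<sigma> (drop 1 stk))"
      by (simp add: code_def)
    also have "\<dots> = foldl (\<lambda>r x. Suc (pair x r)) (list_encode (map \<sigma> (drop 1 stk))) (rev (\<alpha> b # map \<sigma> stk'))"
      by (simp only: foldl_list_code_Cons)
    also have "rev (\<alpha> b # map \<sigma> stk') = list_decode (tab (\<kappa> (l, a, t)))"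
      using tab(2)[OF True st(2) t] act by simp
    also have "\<kappa> (l, a, t) = pair l (pair (pfst (code (stk, a) - 1)) (pfst (psnd (code (stk, a) - 1) - 1)))"
      using list_code_hd_tl(2)[of 0] by (cases stk) (auto simp: \<kappa>_def \<tau>_def t_def code_def)
    also have "list_encode (map \<sigma> (drop 1 stk)) = psnd (psnd (code (stk, a) - 1) - 1)"
      using list_code_hd_tl(2)[of 0] by (cases stk) (auto simp: code_def)
    finally show ?thesis using True n by (simp add: step_def)
  qed
  show ?thesis
  proof (rule that[of "code \<circ> nf" step "\<lambda>y. length (list_decode y) - 1"])
    show "computable (\<lambda>y. length (list_decode y) - 1)" by (intro computability)
    show "length (list_decode ((code \<circ> nf) g)) - 1 = len g" for g
      by (simp add: code_def len_def stack_def split: prod.splits)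
  qed (fact inj 1 2)+
qed

end

section \<open>Amalgams given by presentations\<close>

lemma word_eq_mono:
  assumes "word_eq X R u v" "X \<subseteq> X'" "R \<subseteq> R'"
  shows "word_eq X' R' u v"
proof -
  have w: "words X \<subseteq> words X'" using assms(2) by (auto simp: words_def)
  show ?thesis
    using assms(1)
  proof induction
    case (cancel u v x b)
    then show ?case using w assms(2) by (intro word_eq.cancel) auto
  next
    case (relator u v r)
    then show ?case using w assms(3) by (intro word_eq.relator) auto
  qed (use w in \<open>auto intro: word_eq.intros\<close>)
qed

lemma words_append [simp]: "u @ v \<in> words X \<longleftrightarrow> u \<in> words X \<and> v \<in> words X"
  and words_Nil [simp]: "[] \<in> words X"
  and words_Cons [simp]: "l # u \<in> words X \<longleftrightarrow> fst l \<in> X \<and> u \<in> words X"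
  by (auto simp: words_def mem_Times_iff)

lemma word_class_in_carrier [simp, intro]: "w \<in> words X \<Longrightarrow> word_class X R w \<in> carrier (presented_group X R)"
  by (simp add: carrier_presented_group)

lemma word_class_SOME:
  assumes "w \<in> words X"
  shows "word_eq X R w (SOME u. u \<in> word_class X R w)"
proof -
  have "w \<in> word_class X R w" using assms by (simp add: word_class_def word_eq.refl)
  then have "(SOME u. u \<in> word_class X R w) \<in> word_class X R w" by (rule someI)
  then show ?thesis by (simp add: word_class_def)
qed

locale presented_amalgam =
  fixes X1 X2 :: "'x set" and R1 R2 :: "'x word set" and A :: "('a, 'm) monoid_scheme" and Y :: "'a set"
    and \<phi>1 \<phi>2 :: "'a \<Rightarrow> 'x word set"
  assumes finite_X: "finite X1" "finite X2" and disjoint: "X1 \<inter> X2 = {}"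
    and R_words: "R1 \<subseteq> words X1" "R2 \<subseteq> words X2"
    and finite_groups: "finite (carrier (presented_group X1 R1))" "finite (carrier (presented_group X2 R2))"
    and group_A: "group A" and Y: "Y \<subseteq> carrier A" "generate A Y = carrier A"
    and mon: "\<phi>1 \<in> mon A (presented_group X1 R1)" "\<phi>2 \<in> mon A (presented_group X2 R2)"
begin

text \<open>The two factors are indexed by truth values, which makes them a family as required above.\<close>

definition "Xs b = (if b then X1 else X2)"
definition "Rs b = (if b then R1 else R2)"
definition "\<phi> b = (if b then \<phi>1 else \<phi>2)"
definition "X = X1 \<union> X2"
definition "R = amalgam_relators R1 R2 Y \<phi>1 \<phi>2"

abbreviation "G \<equiv> presented_group X R"
abbreviation "Gr b \<equiv> presented_group (Xs b) (Rs b)"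
abbreviation "cls \<equiv> word_class X R"
abbreviation "fcls b \<equiv> word_class (Xs b) (Rs b)"

sublocale amalgam Gr A \<phi>
  by (rule amalgam.intro) (use group_presented_group group_A mon in \<open>auto simp: Xs_def Rs_def \<phi>_def\<close>)

lemma Xs_subset: "Xs b \<subseteq> X" and Rs_subset: "Rs b \<subseteq> R"
  by (auto simp: Xs_def X_def Rs_def R_def amalgam_relators_def)

lemma words_Xs: "w \<in> words (Xs b) \<Longrightarrow> w \<in> words X"
  using Xs_subset[of b] by (auto simp: words_def)

text \<open>A class of words for a factor is contained in a single class of words for \<open>G\<close>, so any of its members
  determines the image.\<close>

definition \<iota> :: "bool \<Rightarrow> 'x word set \<Rightarrow> 'x word set" where
  "\<iota> b U = cls (SOME u. u \<in> U)"

lemma incl_cls: "w \<in> words (Xs b) \<Longrightarrow> \<iota> b (fcls b w) = cls w"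
  unfolding \<iota>_def using word_class_eqI[OF word_eq_mono[OF word_class_SOME[of w "Xs b" "Rs b"] Xs_subset Rs_subset]]
  by simp

lemma factor_cases:
  assumes "x \<in> carrier (Gr b)"
  obtains w where "w \<in> words (Xs b)" "x = fcls b w"
  using assms by (auto simp: carrier_presented_group)

lemma incl_is_hom: "\<iota> b \<in> hom (Gr b) G"
proof (rule homI)
  show "\<iota> b x \<in> carrier G" if "x \<in> carrier (Gr b)" for x
    using that by (elim factor_cases) (auto simp: incl_cls words_Xs)
  show "\<iota> b (x \<otimes>\<^bsub>Gr b\<^esub> y) = \<iota> b x \<otimes>\<^bsub>G\<^esub> \<iota> b y" if "x \<in> carrier (Gr b)" "y \<in> carrier (Gr b)" for x y
    using that by (elim factor_cases) (simp add: incl_cls words_Xs mult_presented_group)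
qed

lemma mem_emb:
  assumes "a \<in> carrier A" "u \<in> \<phi> b a"
  shows "u \<in> words (Xs b)" "fcls b u = \<phi> b a"
proof -
  obtain w where w: "w \<in> words (Xs b)" "\<phi> b a = fcls b w" using emb_closed[OF assms(1), of b] by (elim factor_cases)
  then have "word_eq (Xs b) (Rs b) w u" using assms(2) by (simp add: word_class_def)
  then show "u \<in> words (Xs b)" "fcls b u = \<phi> b a"
    using w word_eq_words word_class_eqI by (blast, metis)
qed

lemma emb_nonempty:
  assumes "a \<in> carrier A"
  shows "\<exists>u. u \<in> \<phi> b a"
  using emb_closed[OF assms, of b] by (elim factor_cases) (auto simp: word_class_def intro: word_eq.refl)

lemma incl_agree_Y:
  assumes "a \<in> Y"
  shows "\<iota> True (\<phi> True a) = \<iota> False (\<phi> False a)"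
proof -
  have a: "a \<in> carrier A" using assms Y by auto
  obtain u v where uv: "u \<in> \<phi> True a" "v \<in> \<phi> False a" using emb_nonempty[OF a] by blast
  note u = mem_emb[OF a uv(1)] and v = mem_emb[OF a uv(2)]
  have w: "u \<in> words X" "v \<in> words X" using u v words_Xs by auto
  have r: "u @ word_inv v \<in> R"
    unfolding R_def amalgam_relators_def using assms uv by (auto simp: \<phi>_def)
  have "word_eq X R ([] @ (u @ word_inv v) @ v) ([] @ v)"
    by (rule word_eq.relator) (use r w word_inv_in_words in auto)
  moreover have "word_eq X R (u @ (word_inv v @ v)) (u @ [])"
    using word_eq_append_left[OF word_eq_inv_left] w by blast
  ultimately have "word_eq X R u v"
    using word_eq.trans word_eq.sym by (metis append.assoc append_Nil append_Nil2)
  then show ?thesis using incl_cls[OF u(1)] incl_cls[OF v(1)] u v word_class_eqI by metis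
qed

text \<open>Two homomorphisms from \<open>A\<close> that agree on the generating set \<open>Y\<close> are equal.\<close>

lemma incl_agree:
  assumes "a \<in> carrier A"
  shows "\<iota> b (\<phi> b a) = \<iota> True (\<phi> True a)"
proof -
  interpret A: group A by (rule group_A)
  have h: "(\<lambda>a. \<iota> b (\<phi> b a)) \<in> hom A G" for b
    using hom_compose[OF emb_hom incl_is_hom] by (simp add: comp_def)
  have gh: "group_hom A G (\<lambda>a. \<iota> b (\<phi> b a))" for b
    by (intro group_hom.intro group_A group_presented_group group_hom_axioms.intro h)
  have "a \<in> generate A Y" using assms Y by simp
  then have "a \<in> carrier A \<and> \<iota> False (\<phi> False a) = \<iota> True (\<phi> True a)"
  proof induction
    case one
    then show ?case using group_hom.hom_one[OF gh] by simp
  next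
    case (incl a)
    then show ?case using incl_agree_Y[of a] Y by auto
  next
    case (inv a)
    then have "a \<in> carrier A" using Y by auto
    then show ?case using group_hom.hom_inv[OF gh] incl_agree_Y[OF inv] by simp
  next
    case (eng a1 a2)
    then show ?case using group_hom.hom_mult[OF gh] by simp
  qed
  then show ?thesis by (cases b) auto
qed

text \<open>The letter determines its factor, since the two alphabets are disjoint.\<close>

definition letter_act where
  "letter_act st l = act (fst l \<in> X1) (fcls (fst l \<in> X1) [l]) st"

definition run where "run st w = foldl letter_act st w"

lemma run_append: "run st (u @ v) = run (run st u) v"
  by (simp add: run_def)

lemma idx: "x \<in> Xs b \<Longrightarrow> x \<in> X1 \<longleftrightarrow> b"
  using disjoint by (auto simp: Xs_def split: if_splits)

text \<open>Reading a word of one factor letter by letter amounts to acting once with the element of the factor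
  that it spells.\<close>

lemma run_factor: "w \<in> words (Xs b) \<Longrightarrow> st \<in> states \<Longrightarrow> run st w = act b (fcls b w) st"
proof (induction w arbitrary: st)
  case Nil
  then show ?case using act_one[of st b] by (simp add: run_def one_presented_group)
next
  case (Cons l w)
  then have l: "fst l \<in> Xs b" and w: "w \<in> words (Xs b)" and lw: "[l] \<in> words (Xs b)" by auto
  then have "run st (l # w) = run (act b (fcls b [l]) st) w"
    by (simp add: run_def letter_act_def idx)
  also have "\<dots> = act b (fcls b w) (act b (fcls b [l]) st)"
    using Cons lw w by (intro Cons.IH act_in) auto
  also have "\<dots> = act b (fcls b [l] \<otimes>\<^bsub>Gr b\<^esub> fcls b w) st" using Cons lw w by (simp add: act_mult)
  finally show ?case using lw w by (simp add: mult_presented_group)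
qed

lemma letter_cases:
  assumes "x \<in> X"
  obtains b where "x \<in> Xs b"
  using assms that[of True] that[of False] by (auto simp: X_def Xs_def)

lemma run_in: "w \<in> words X \<Longrightarrow> st \<in> states \<Longrightarrow> run st w \<in> states"
proof (induction w arbitrary: st)
  case (Cons l w)
  then have "fst l \<in> X" by simp
  then obtain b where "fst l \<in> Xs b" by (rule letter_cases)
  then have "[l] \<in> words (Xs b)" by simp
  then have "run st [l] \<in> states" using Cons.prems by (simp add: run_factor act_in)
  then show ?case using Cons run_append[of st "[l]" w] by simp
qed (simp add: run_def)

lemma run_trivial:
  assumes "word_eq (Xs b) (Rs b) w []" "st \<in> states"
  shows "run st w = st"
proof -
  have w: "w \<in> words (Xs b)" using word_eq_words[OF assms(1)] by simp
  have "run st w = act b (fcls b w) st" by (rule run_factor[OF w assms(2)])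
  also have "fcls b w = \<one>\<^bsub>Gr b\<^esub>"
    unfolding one_presented_group by (rule word_class_eqI[OF assms(1)])
  finally show ?thesis by (simp only: act_one[OF assms(2)])
qed

text \<open>A relator of a factor acts as the unit of that factor.  In a relator \<open>u @ word_inv v\<close> that identifies
  the two images of some \<open>a\<close>, the words \<open>u\<close> and \<open>v\<close> both multiply by \<open>a\<close>, although they come from
  different factors.\<close>

lemma run_relator:
  assumes r: "r \<in> R" and st: "st \<in> states"
  shows "run st r = st"
proof -
  consider b where "r \<in> Rs b" | a u v where "a \<in> Y" "u \<in> \<phi> True a" "v \<in> \<phi> False a" "r = u @ word_inv v"
  proof -
    have "(\<exists>b. r \<in> Rs b) \<or> (\<exists>a u v. a \<in> Y \<and> u \<in> \<phi> True a \<and> v \<in> \<phi> False a \<and> r = u @ word_inv v)"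
      using r by (auto simp: R_def amalgam_relators_def Rs_def \<phi>_def ex_bool_eq)
    then show thesis using that by blast
  qed
  then show ?thesis
  proof cases
    case 1
    then have "r \<in> words (Xs b)" using R_words by (auto simp: Xs_def Rs_def split: if_splits)
    then have "word_eq (Xs b) (Rs b) ([] @ r @ []) ([] @ [])" using 1 by (intro word_eq.relator) auto
    then show ?thesis using run_trivial[of b r] st by simp
  next
    case 2
    have a: "a \<in> carrier A" using 2 Y by auto
    note u = mem_emb[OF a 2(2)] and v = mem_emb[OF a 2(3)]
    have "run st u = run st v"
      using u v st a by (cases st) (simp add: run_factor act_emb)
    then have "run st r = run st (v @ word_inv v)" using 2 by (simp add: run_append)
    moreover have "word_inv (word_inv v) = v"
      by (simp add: word_inv_def rev_map comp_def split_beta)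
    then have "word_eq (Xs False) (Rs False) (v @ word_inv v) []"
      using word_eq_inv_left[OF word_inv_in_words[OF v(1)]] by simp
    ultimately show ?thesis using run_trivial st by simp
  qed
qed

text \<open>The heart of the normal form theorem: words with the same value in \<open>G\<close> act in the same way on
  states.\<close>

lemma run_word_eq: "word_eq X R u v \<Longrightarrow> st \<in> states \<Longrightarrow> run st u = run st v"
proof (induction rule: word_eq.induct)
  case (cancel u v x b)
  obtain k where "x \<in> Xs k" using cancel by (blast elim: letter_cases)
  then have "word_eq (Xs k) (Rs k) ([] @ [(x, b), (x, \<not> b)] @ []) ([] @ [])"
    by (intro word_eq.cancel) auto
  from run_trivial[OF this[simplified]] show ?case
    using cancel run_in[of u st] run_append[of "run st u" "[(x, b), (x, \<not> b)]" v]
    by (simp add: run_append)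
next
  case (relator u v r)
  then show ?case using run_in[of u st] by (simp add: run_append run_relator)
qed auto

abbreviation start where "start \<equiv> ([], \<one>\<^bsub>A\<^esub>)"

lemma start_in: "start \<in> states"
  using group_A by (simp add: states_def group.is_monoid)

definition nf where "nf U = run start (SOME u. u \<in> U)"

lemma nf_cls: "w \<in> words X \<Longrightarrow> nf (cls w) = run start w"
  using run_word_eq[OF word_class_SOME start_in] by (simp add: nf_def)

sublocale amalgamated_product Gr A \<phi> G \<iota> "\<lambda>a. \<iota> True (\<phi> True a)" nf
proof (intro amalgamated_product.intro amalgamated_product_axioms.intro amalgam_axioms group_presented_group)
  show "\<iota> b \<in> hom (Gr b) G" for b by (rule incl_is_hom)
  show "a \<in> carrier A \<Longrightarrow> \<iota> b (\<phi> b a) = \<iota> True (\<phi> True a)" for a b by (rule incl_agree)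
  show "nf \<one>\<^bsub>G\<^esub> = start" by (simp add: one_presented_group nf_cls) (simp add: run_def)
  show "nf (g \<otimes>\<^bsub>G\<^esub> \<iota> b x) = act b x (nf g)" if g: "g \<in> carrier G" and x: "x \<in> carrier (Gr b)" for g b x
  proof -
    obtain w where w: "w \<in> words X" "g = cls w" using g by (auto simp: carrier_presented_group)
    obtain u where u: "u \<in> words (Xs b)" "x = fcls b u" using x by (elim factor_cases)
    then have "u \<in> words X" by (simp add: words_Xs)
    then have "nf (g \<otimes>\<^bsub>G\<^esub> \<iota> b x) = run (run start w) u"
      using w u by (simp add: incl_cls mult_presented_group nf_cls run_append)
    then show ?thesis using w u run_in[OF w(1) start_in] by (simp add: run_factor nf_cls)
  qed
  show "finite (carrier (Gr b))" for b using finite_groups by (simp add: Xs_def Rs_def)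
  show "finite (UNIV :: bool set)" by simp
  fix g assume "g \<in> carrier G"
  then obtain w where w: "w \<in> words X" "g = cls w" by (auto simp: carrier_presented_group)
  define f where "f l = (fst l \<in> X1, fcls (fst l \<in> X1) [l])" for l :: "'x \<times> bool"
  have l: "snd (f l) \<in> carrier (Gr (fst (f l))) \<and> \<iota> (fst (f l)) (snd (f l)) = cls [l]" if l: "fst l \<in> X" for l
  proof -
    obtain b where b: "fst l \<in> Xs b" using l by (rule letter_cases)
    then have "[l] \<in> words (Xs b)" by simp
    then show ?thesis using idx[OF b] by (auto simp: f_def incl_cls)
  qed
  have "set (map f w) \<subseteq> {(i, x). x \<in> carrier (Gr i)} \<and>
      cls w = foldl (\<lambda>g (i, x). g \<otimes>\<^bsub>G\<^esub> \<iota> i x) \<one>\<^bsub>G\<^esub> (map f w)"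
    using w(1)
  proof (induction w rule: rev_induct)
    case (snoc l w)
    then show ?case
      using l[of l] mult_presented_group[of w X "[l]" R] by (cases "f l") auto
  qed (simp add: one_presented_group)
  then show "\<exists>ls. set ls \<subseteq> {(i, x). x \<in> carrier (Gr i)} \<and> g = foldl (\<lambda>g (i, x). g \<otimes>\<^bsub>G\<^esub> \<iota> i x) \<one>\<^bsub>G\<^esub> ls"
    using w(2) by blast
qed

lemma cls_lprod: "w \<in> words X \<Longrightarrow> cls w = group.lprod G (map (\<lambda>l. cls [l]) w)"
proof (induction w)
  case (Cons l w)
  then show ?case using mult_presented_group[of "[l]" X w R] by simp
qed (simp add: one_presented_group)

text \<open>Numbers that are not codes of letters are given the value \<open>\<one>\<close>, so that every number is the code of a
  list of words; on codes of words over the alphabet, the values are those in \<open>G\<close>.\<close>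

lemma intersection_algorithm:
  assumes c: "inj_on c X"
  shows "\<exists>f. recursive 2 f \<and>
      (\<forall>hs ks. set hs \<subseteq> words X \<and> set ks \<subseteq> words X \<longrightarrow>
        (\<exists>ls. set ls \<subseteq> words X \<and>
          f [words_code c hs, words_code c ks] = words_code c ls \<and>
          generate G (cls ` set ls) = generate G (cls ` set hs) \<inter> generate G (cls ` set ks)))"
proof -
  define lc where "lc = (\<lambda>(x, b). 2 * c x + of_bool b :: nat)"
  define L where "L = X \<times> (UNIV :: bool set)"
  have inj: "inj_on lc L"
  proof (rule inj_onI)
    fix l l' assume l: "l \<in> L" "l' \<in> L" and eq: "lc l = lc l'"
    obtain x b x' b' where [simp]: "l = (x, b)" "l' = (x', b')" by fastforce
    have "odd (lc l) = b" "odd (lc l') = b'" "lc l div 2 = c x" "lc l' div 2 = c x'" by (simp_all add: lc_def)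
    with eq have "b = b'" "c x = c x'" by auto
    then show "l = l'" using l c by (auto simp: L_def dest: inj_onD)
  qed
  define dec where "dec = inv_into L lc"
  define \<Lambda> where "\<Lambda> = lc ` L"
  have dec: "dec (lc l) = l" if "l \<in> L" for l using that inj by (simp add: dec_def)
  define val where "val n = (if n \<in> \<Lambda> then cls [dec n] else \<one>\<^bsub>G\<^esub>)" for n
  have words_L: "w \<in> words X \<longleftrightarrow> set w \<subseteq> L" for w by (auto simp: words_def L_def)
  have val_lc: "val (lc l) = cls [l]" if "l \<in> L" for l using that dec by (simp add: val_def \<Lambda>_def)
  have val_incl: "\<exists>b x. x \<in> carrier (Gr b) \<and> val n = \<iota> b x" if n: "n \<in> \<Lambda>" for n
  proof -
    obtain l where l: "l \<in> L" "n = lc l" using n by (auto simp: \<Lambda>_def)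
    then have "fst l \<in> X" by (auto simp: L_def)
    then obtain b where "fst l \<in> Xs b" by (rule letter_cases)
    then have "[l] \<in> words (Xs b)" by simp
    then show ?thesis using val_lc[OF l(1)] l incl_cls by (metis word_class_in_carrier)
  qed
  have val_one: "val n = \<one>\<^bsub>G\<^esub>" if "n \<notin> \<Lambda>" for n using that by (simp add: val_def)
  have fin: "finite \<Lambda>" using finite_X by (simp add: \<Lambda>_def L_def X_def)
  obtain \<nu> step hgt where coding: "inj_on \<nu> (carrier G)"
    "\<And>g l. g \<in> carrier G \<Longrightarrow> \<nu> (g \<otimes>\<^bsub>G\<^esub> val l) = step (\<nu> g) l"
    "computable (\<lambda>z. step (pfst z) (psnd z))" "computable hgt" "\<And>g. g \<in> carrier G \<Longrightarrow> hgt (\<nu> g) = len g"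
    by (rule state_coding[of \<Lambda> val, OF fin val_incl val_one], assumption, assumption) (rule that)
  have cls_map: "cls w = lprod (map val (map lc w))" if "w \<in> words X" for w
  proof -
    have "map val (map lc w) = map (\<lambda>l. cls [l]) w" using that by (auto simp: words_L val_lc)
    then show ?thesis using cls_lprod[OF that] by (simp only:)
  qed
  interpret alg: computable_tree_length G len pre val \<Lambda> \<nu> step hgt "\<lambda>m. (card symbols + 1) ^ m * card (carrier A)"
  proof unfold_locales
    show vc: "val l \<in> carrier G" for l using val_incl[of l] incl_closed by (cases "l \<in> \<Lambda>") (auto simp: val_def)
    show "len (val l) \<le> 1" for l
    proof (cases "l \<in> \<Lambda>")
      case True
      then obtain b x where "x \<in> carrier (Gr b)" "val l = \<iota> b x" using val_incl by blast
      then show ?thesis using len_mult_incl[of "\<one>\<^bsub>G\<^esub>" x b] len_one by simp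
    qed (simp add: val_def len_one)
    show "\<exists>w\<in>lists \<Lambda>. g = lprod (map val w)" if g: "g \<in> carrier G" for g
    proof -
      obtain w where w: "w \<in> words X" "g = cls w" using g by (auto simp: carrier_presented_group)
      then have "set (map lc w) \<subseteq> \<Lambda>" unfolding \<Lambda>_def words_L set_map by blast
      then have "map lc w \<in> lists \<Lambda>" by (simp only: in_lists_conv_set) blast
      then show ?thesis using cls_map w by blast
    qed
    show "computable (\<lambda>m. (card symbols + 1) ^ m * card (carrier A))" by (intro computability)
    show "card {g \<in> carrier G. len g \<le> m} \<le> (card symbols + 1) ^ m * card (carrier A)" for m
      by (rule ball_bound)
  qed (use fin coding in auto)
  obtain F where F: "computable F" "\<And>h k.
      (\<forall>w\<in>set (list_decode (F (pair h k))). set (list_decode w) \<subseteq> \<Lambda>) \<and>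
      alg.subgrp (F (pair h k)) = alg.subgrp h \<inter> alg.subgrp k"
    using alg.intersection_computable by blast
  have "recfn 2 (\<lambda>xs. F (pair (xs ! 0) (xs ! 1)))"
    by (intro computable_recfn[OF F(1)] recfn_pair recfn_nth) auto
  then obtain f where f: "recursive 2 f" "\<And>h k. f [h, k] = F (pair h k)"
    unfolding recfn_def by force
  have word_code: "word_code c w = list_encode (map lc w)" for w by (simp add: word_code_def lc_def)
  have gens: "alg.gens (words_code c hs) = cls ` set hs" if "set hs \<subseteq> words X" for hs
  proof -
    have ev: "alg.ev (word_code c w) = cls w" if "w \<in> words X" for w
      unfolding alg.ev_def word_code list_encode_inverse by (rule cls_map[OF that, symmetric])
    have "alg.gens (words_code c hs) = (\<lambda>w. alg.ev (word_code c w)) ` set hs"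
      by (simp only: alg.gens_def words_code_def list_encode_inverse set_map image_image)
    also have "\<dots> = cls ` set hs" by (rule image_cong[OF HOL.refl ev]) (use that in blast)
    finally show ?thesis .
  qed
  show ?thesis
  proof (intro exI[of _ f] conjI allI impI f(1))
    fix hs ks assume hk: "set hs \<subseteq> words X \<and> set ks \<subseteq> words X"
    define n where "n = F (pair (words_code c hs) (words_code c ks))"
    define ls where "ls = map (\<lambda>w. map dec (list_decode w)) (list_decode n)"
    have n: "\<And>w. w \<in> set (list_decode n) \<Longrightarrow> set (list_decode w) \<subseteq> \<Lambda>"
      "alg.subgrp n = alg.subgrp (words_code c hs) \<inter> alg.subgrp (words_code c ks)"
      using F(2) by (auto simp: n_def)
    have d: "dec l \<in> L \<and> lc (dec l) = l" if "l \<in> \<Lambda>" for l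
      using that by (auto simp: \<Lambda>_def dec)
    have "set (map dec (list_decode w)) \<subseteq> L" if "w \<in> set (list_decode n)" for w
      using n(1)[OF that] d by (simp only: set_map) blast
    then have ls: "set ls \<subseteq> words X" by (auto simp only: ls_def words_L set_map)
    have "map (word_code c) ls = list_decode n"
      unfolding ls_def map_map
    proof (rule map_idI)
      fix w assume "w \<in> set (list_decode n)"
      then have "map lc (map dec (list_decode w)) = list_decode w"
        using n(1) d by (simp add: map_idI subset_iff)
      then show "(word_code c \<circ> (\<lambda>w. map dec (list_decode w))) w = w" by (simp add: word_code)
    qed
    then have "words_code c ls = n" by (simp add: words_code_def)
    then show "\<exists>ls. set ls \<subseteq> words X \<and> f [words_code c hs, words_code c ks] = words_code c ls \<and>
        generate G (cls ` set ls) = generate G (cls ` set hs) \<inter> generate G (cls ` set ks)"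
      using ls n(2) gens[OF ls] gens hk f(2) by (intro exI[of _ ls]) (auto simp: n_def)
  qed
qed

end

theorem corollary7p7:
  fixes X1 X2 X :: "'x set"
    and R1 R2 R :: "'x word set"
    and A :: "('a, 'm) monoid_scheme"
    and Y :: "'a set"
    and \<phi>1 \<phi>2 :: "'a \<Rightarrow> 'x word set"
    and G :: "'x word set monoid"
    and c :: "'x \<Rightarrow> nat"
  assumes "finite X1" and "finite X2" and "X1 \<inter> X2 = {}"
    and "finite R1" and "R1 \<subseteq> words X1"
    and "finite R2" and "R2 \<subseteq> words X2"
    and "finite (carrier (presented_group X1 R1))"
    and "finite (carrier (presented_group X2 R2))"
    and "group A" and "Y \<subseteq> carrier A" and "generate A Y = carrier A"
    and "\<phi>1 \<in> mon A (presented_group X1 R1)"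
    and "\<phi>2 \<in> mon A (presented_group X2 R2)"
    and "X = X1 \<union> X2"
    and "R = amalgam_relators R1 R2 Y \<phi>1 \<phi>2"
    and "G = presented_group X R"
    and "inj_on c X"
  shows "(\<forall>H K. finitely_generated G H \<and> finitely_generated G K \<longrightarrow> finitely_generated G (H \<inter> K)) \<and>
    (\<exists>f. recursive 2 f \<and>
      (\<forall>hs ks. set hs \<subseteq> words X \<and> set ks \<subseteq> words X \<longrightarrow>
        (\<exists>ls. set ls \<subseteq> words X \<and>
          f [words_code c hs, words_code c ks] = words_code c ls \<and>
          generate G (word_class X R ` set ls) =
            generate G (word_class X R ` set hs) \<inter> generate G (word_class X R ` set ks))))"
proof -
  interpret P: presented_amalgam X1 X2 R1 R2 A Y \<phi>1 \<phi>2
    using assms by (intro presented_amalgam.intro)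
  have [simp]: "P.X = X" "P.R = R" using assms by (simp_all add: P.X_def P.R_def)
  show ?thesis
    using P.finitely_generated_inter P.intersection_algorithm[of c] assms by simp
qed

end
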